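(* Let $\alpha$ be a transitive unital partial action of a group $G$ on a $K$-algebra $\mathcal A=\prod_{\lambda\in\Lambda}\mathcal A_\lambda$, where each $\mathcal A_\lambda$ is an indecomposable unital ring. Let $n>0$ and $w\in Z^n_{par}(G,\mathcal A)$. Then $w=\delta^{n-1}\varepsilon+w'$, where $w'\in C^n_{par}(G,\mathcal A)$ and $\varepsilon\in C^{n-1}_{par}(G,\mathcal A)$ are defined by $$w'(x_1,\dots,x_n)=1_{(x_1,\dots,x_n)}\prod_{g\in\Lambda}\theta_g\big(w(\tau_n^g(x_1,\dots,x_n))\big),$$ $$\varepsilon(x_1,\dots,x_{n-1})=1_{(x_1,\dots,x_{n-1})}\prod_{g\in\Lambda}\theta_g\Big(\sum_{i=0}^{n-1}(-1)^iw(\sigma_{n-1,i}^g(x_1,\dots,x_{n-1}))\Big),$$ the latter being understood as $\varepsilon=\prod_{g\in\Lambda}\theta_g(w(g^{-1}))\in\mathcal A$ when $n=1$. In particular, $w'\in Z^n_{par}(G,\mathcal A)$.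
   Context: $K$ is a commutative unital ring; algebras are associative, not necessarily commutative. A unital ring is indecomposable if it is nonzero and its only central idempotents are $0,1$. Each $\mathcal A_\lambda$ is identified with the ideal $1_{\mathcal A_\lambda}\mathcal A$ of $\mathcal A$, and $\mathrm{pr}_\lambda:\mathcal A\to\mathcal A_\lambda$ (multiplication by $1_{\mathcal A_\lambda}$) is the projection. For $a_\lambda\in\mathcal A_\lambda$ ($\lambda\in\Lambda$), $\prod_{\lambda\in\Lambda}a_\lambda$ denotes the element of $\mathcal A$ whose $\lambda$-component is $a_\lambda$. Partial action $\alpha$ of $G$ on $\mathcal A$: two-sided ideals $\mathcal D_g$ and algebra isomorphisms $\alpha_g:\mathcal D_{g^{-1}}\to\mathcal D_g$ ($g\in G$) with $\alpha_1=\mathrm{id}_{\mathcal A}$, and if $a\in\mathcal D_{h^{-1}}$, $\alpha_h(a)\in\mathcal D_{g^{-1}}$, then $a\in\mathcal D_{(gh)^{-1}}$ and $\alpha_g(\alpha_h(a))=\alpha_{gh}(a)$. Unital: $\mathcal D_g=1_g\mathcal A$ with $1_g$ a central idempotent. Transitive: for all $\lambda',\lambda''\in\Lambda$ there is $x\in G$ with $\mathcal A_{\lambda'}\subseteq\mathcal D_{x^{-1}}$ and $\alpha_x(\mathcal A_{\lambda'})=\mathcal A_{\lambda''}$. Cochains: $1_{(g_1,\dots,g_n)}=1_{g_1}1_{g_1g_2}\cdots1_{g_1\cdots g_n}$; $C^0_{par}(G,\mathcal A)=\mathcal A$, $C^n_{par}(G,\mathcal A)=\{f:G^n\to\mathcal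 A\mid f(g_1,\dots,g_n)\in1_{(g_1,\dots,g_n)}\mathcal A\}$ for $n\ge1$; $(\delta^0a)(g)=\alpha_g(1_{g^{-1}}a)-1_ga$; for $n\ge1$ $$(\delta^nf)(g_1,\dots,g_{n+1})=\alpha_{g_1}(1_{g_1^{-1}}f(g_2,\dots,g_{n+1}))+\sum_{i=1}^n(-1)^i1_{g_1\cdots g_i}f(g_1,\dots,g_ig_{i+1},\dots,g_{n+1})+(-1)^{n+1}1_{g_1\cdots g_{n+1}}f(g_1,\dots,g_n);$$ $Z^n_{par}(G,\mathcal A)=\ker\delta^n$. Index set: fix $\lambda_0\in\Lambda$ and let $H=\{x\in G\mid\mathcal A_{\lambda_0}\subseteq\mathcal D_{x^{-1}},\ \alpha_x(\mathcal A_{\lambda_0})=\mathcal A_{\lambda_0}\}$, a subgroup of $G$. Let $\Lambda'$ be a left transversal of $H$ in $G$ containing $1$. For $x\in G$, $\bar x\in\Lambda'$ is the unique element with $x\in\bar xH$. $\Lambda$ is identified with the subset $\{g\in\Lambda'\mid\mathcal A_{\lambda_0}\subseteq\mathcal D_{g^{-1}}\}$ of $\Lambda'$, so that $\lambda_0$ becomes $1$ and $\mathcal A_g=\alpha_g(\mathcal A_1)$ for $g\in\Lambda$. Maps: for $g\in\Lambda$, $\theta_g:\mathcal A\to\mathcal A_g$, $\theta_g(a)=\alpha_g(\mathrm{pr}_1(a))$. $\eta:G\to H$, $\eta(x)=x^{-1}\bar x$. For $g\in\Lambda'$, $n>0$: $\eta_n^g(x_1,\dots,x_n)=\eta\big(x_n^{-1}\,\overline{x_{n-1}^{-1}\cdots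 x_1^{-1}g}\big)$ (so $\eta_1^g(x_1)=\eta(x_1^{-1}g)$) and $\tau_n^g(x_1,\dots,x_n)=(\eta_1^g(x_1),\eta_2^g(x_1,x_2),\dots,\eta_n^g(x_1,\dots,x_n))\in H^n$. The functions $\sigma_{n,i}^g:G^n\to G^{n+1}$ ($n>0$, $0\le i\le n$) are $\sigma_{n,0}^g(x_1,\dots,x_n)=(g^{-1},x_1,\dots,x_n)$; $\sigma_{n,i}^g(x_1,\dots,x_n)=(\tau_i^g(x_1,\dots,x_i),(\overline{x_i^{-1}\cdots x_1^{-1}g})^{-1},x_{i+1},\dots,x_n)$ for $0<i<n$; $\sigma_{n,n}^g(x_1,\dots,x_n)=(\tau_n^g(x_1,\dots,x_n),(\overline{x_n^{-1}\cdots x_1^{-1}g})^{-1})$; and $\sigma_{0,0}^g=g^{-1}$. *)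

theory Defs
  imports "HOL-Algebra.Module" "HOL-Algebra.Ideal" "HOL-Library.FuncSet"
begin

section \<open>Associative algebras and their products\<close>

text \<open>The library locale \<^locale>\<open>algebra\<close> requires a commutative multiplication; here the algebras
  are associative and unital, but not necessarily commutative.\<close>

locale assoc_algebra = module K A + ring A for K (structure) and A (structure) +
  assumes smult_mult_left:
      "\<lbrakk>c \<in> carrier K; x \<in> carrier A; y \<in> carrier A\<rbrakk> \<Longrightarrow>
        (c \<odot>\<^bsub>A\<^esub> x) \<otimes>\<^bsub>A\<^esub> y = c \<odot>\<^bsub>A\<^esub> (x \<otimes>\<^bsub>A\<^esub> y)"
    and smult_mult_right:
      "\<lbrakk>c \<in> carrier K; x \<in> carrier A; y \<in> carrier A\<rbrakk> \<Longrightarrow>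
        x \<otimes>\<^bsub>A\<^esub> (c \<odot>\<^bsub>A\<^esub> y) = c \<odot>\<^bsub>A\<^esub> (x \<otimes>\<^bsub>A\<^esub> y)"

definition central_idempotent :: "('a, 'm) ring_scheme \<Rightarrow> 'a \<Rightarrow> bool" where
  "central_idempotent R e \<longleftrightarrow>
     e \<in> carrier R \<and> e \<otimes>\<^bsub>R\<^esub> e = e \<and> (\<forall>x \<in> carrier R. e \<otimes>\<^bsub>R\<^esub> x = x \<otimes>\<^bsub>R\<^esub> e)"

definition indecomposable_ring :: "('a, 'm) ring_scheme \<Rightarrow> bool" where
  "indecomposable_ring R \<longleftrightarrow>
     ring R \<and> \<one>\<^bsub>R\<^esub> \<noteq> \<zero>\<^bsub>R\<^esub> \<and>
     (\<forall>e. central_idempotent R e \<longrightarrow> e = \<zero>\<^bsub>R\<^esub> \<or> e = \<one>\<^bsub>R\<^esub>)"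

definition prod_algebra :: "'i set \<Rightarrow> ('i \<Rightarrow> ('k, 'a) module) \<Rightarrow> ('k, 'i \<Rightarrow> 'a) module" where
  "prod_algebra I A =
     \<lparr>carrier = (\<Pi>\<^sub>E i\<in>I. carrier (A i)),
      mult = (\<lambda>f h. \<lambda>i\<in>I. f i \<otimes>\<^bsub>A i\<^esub> h i),
      one = (\<lambda>i\<in>I. \<one>\<^bsub>A i\<^esub>),
      zero = (\<lambda>i\<in>I. \<zero>\<^bsub>A i\<^esub>),
      add = (\<lambda>f h. \<lambda>i\<in>I. f i \<oplus>\<^bsub>A i\<^esub> h i),
      smult = (\<lambda>c f. \<lambda>i\<in>I. c \<odot>\<^bsub>A i\<^esub> f i)\<rparr>"

text \<open>The unit of the factor \<open>A i\<close>, seen as an element of the product, and the factor \<open>A i\<close> itself,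
  seen as the ideal which this element generates.\<close>

definition factor_one :: "'i set \<Rightarrow> ('i \<Rightarrow> ('k, 'a) module) \<Rightarrow> 'i \<Rightarrow> 'i \<Rightarrow> 'a" where
  "factor_one I A i = (\<lambda>j\<in>I. if j = i then \<one>\<^bsub>A j\<^esub> else \<zero>\<^bsub>A j\<^esub>)"

definition factor :: "'i set \<Rightarrow> ('i \<Rightarrow> ('k, 'a) module) \<Rightarrow> 'i \<Rightarrow> ('i \<Rightarrow> 'a) set" where
  "factor I A i =
     (\<lambda>a. factor_one I A i \<otimes>\<^bsub>prod_algebra I A\<^esub> a) ` carrier (prod_algebra I A)"


section \<open>Unital partial actions\<close>

locale partial_action = group G + assoc_algebra K A
  for G (structure) and K (structure) and A (structure) +
  fixes D :: "'g \<Rightarrow> 'a set" and \<alpha> :: "'g \<Rightarrow> 'a \<Rightarrow> 'a"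
  assumes dom_ideal: "g \<in> carrier G \<Longrightarrow> ideal (D g) A"
    and act_bij: "g \<in> carrier G \<Longrightarrow> bij_betw (\<alpha> g) (D (inv\<^bsub>G\<^esub> g)) (D g)"
    and act_add: "\<lbrakk>g \<in> carrier G; a \<in> D (inv\<^bsub>G\<^esub> g); b \<in> D (inv\<^bsub>G\<^esub> g)\<rbrakk> \<Longrightarrow>
          \<alpha> g (a \<oplus>\<^bsub>A\<^esub> b) = \<alpha> g a \<oplus>\<^bsub>A\<^esub> \<alpha> g b"
    and act_mult: "\<lbrakk>g \<in> carrier G; a \<in> D (inv\<^bsub>G\<^esub> g); b \<in> D (inv\<^bsub>G\<^esub> g)\<rbrakk> \<Longrightarrow>
          \<alpha> g (a \<otimes>\<^bsub>A\<^esub> b) = \<alpha> g a \<otimes>\<^bsub>A\<^esub> \<alpha> g b"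
    and act_smult: "\<lbrakk>g \<in> carrier G; c \<in> carrier K; a \<in> D (inv\<^bsub>G\<^esub> g)\<rbrakk> \<Longrightarrow>
          \<alpha> g (c \<odot>\<^bsub>A\<^esub> a) = c \<odot>\<^bsub>A\<^esub> \<alpha> g a"
    and dom_one: "D \<one>\<^bsub>G\<^esub> = carrier A"
    and act_one: "a \<in> carrier A \<Longrightarrow> \<alpha> \<one>\<^bsub>G\<^esub> a = a"
    and act_comp_dom: "\<lbrakk>g \<in> carrier G; h \<in> carrier G; a \<in> D (inv\<^bsub>G\<^esub> h); \<alpha> h a \<in> D (inv\<^bsub>G\<^esub> g)\<rbrakk> \<Longrightarrow>
          a \<in> D (inv\<^bsub>G\<^esub> (g \<otimes>\<^bsub>G\<^esub> h))"
    and act_comp: "\<lbrakk>g \<in> carrier G; h \<in> carrier G; a \<in> D (inv\<^bsub>G\<^esub> h); \<alpha> h a \<in> D (inv\<^bsub>G\<^esub> g)\<rbrakk> \<Longrightarrow>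
          \<alpha> g (\<alpha> h a) = \<alpha> (g \<otimes>\<^bsub>G\<^esub> h) a"

text \<open>The parameter \<open>u\<close> gives the idempotents \<open>1\<^sub>g\<close>: on \<^term>\<open>carrier G\<close> it is determined by \<open>D\<close>, as
  \<open>u g\<close> is the identity element of \<open>D g\<close>.\<close>

locale unital_partial_action = partial_action +
  fixes u
  assumes unit_central_idempotent: "g \<in> carrier G \<Longrightarrow> central_idempotent A (u g)"
    and dom_eq: "g \<in> carrier G \<Longrightarrow> D g = (\<lambda>a. u g \<otimes>\<^bsub>A\<^esub> a) ` carrier A"


section \<open>Partial cochains\<close>

definition tuples :: "('g, 'm) monoid_scheme \<Rightarrow> nat \<Rightarrow> 'g list set" where
  "tuples G n = {xs. length xs = n \<and> set xs \<subseteq> carrier G}"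

definition mprod :: "('g, 'm) monoid_scheme \<Rightarrow> 'g list \<Rightarrow> 'g" where
  "mprod M xs = foldr (\<lambda>x y. x \<otimes>\<^bsub>M\<^esub> y) xs \<one>\<^bsub>M\<^esub>"

definition tuple_unit ::
    "('g, 'm) monoid_scheme \<Rightarrow> ('a, 'r) ring_scheme \<Rightarrow> ('g \<Rightarrow> 'a) \<Rightarrow> 'g list \<Rightarrow> 'a" where
  "tuple_unit G A u xs = mprod A (map (\<lambda>i. u (mprod G (take i xs))) [1..<Suc (length xs)])"

text \<open>Cochains are extensional functions on \<open>G\<^sup>n\<close>. Here \<open>G\<^sup>0\<close> consists of the empty list only, whose
  \<^const>\<open>tuple_unit\<close> is the unit of \<open>A\<close>, so that \<open>C\<^sup>0\<close> is \<open>A\<close> with \<open>a\<close> encoded as \<open>[] \<mapsto> a\<close>. With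
  this encoding the formula for \<open>\<delta>\<^sup>n\<close>, \<open>n \<ge> 1\<close>, also reads correctly for \<open>n = 0\<close>.\<close>

definition cochains ::
    "('g, 'm) monoid_scheme \<Rightarrow> ('a, 'r) ring_scheme \<Rightarrow> ('g \<Rightarrow> 'a) \<Rightarrow> nat \<Rightarrow> ('g list \<Rightarrow> 'a) set" where
  "cochains G A u n =
     (\<Pi>\<^sub>E xs\<in>tuples G n. (\<lambda>a. tuple_unit G A u xs \<otimes>\<^bsub>A\<^esub> a) ` carrier A)"

text \<open>\<open>(g\<^sub>1, \<dots>, g\<^sub>i g\<^sub>i\<^sub>+\<^sub>1, \<dots>)\<close>; note that \<open>xs ! (i - 1)\<close> is \<open>g\<^sub>i\<close>.\<close>

definition merge_at :: "('g, 'm) monoid_scheme \<Rightarrow> nat \<Rightarrow> 'g list \<Rightarrow> 'g list" where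
  "merge_at G i xs = take (i - 1) xs @ [xs ! (i - 1) \<otimes>\<^bsub>G\<^esub> xs ! i] @ drop (i + 1) xs"

definition coboundary ::
    "('g, 'm) monoid_scheme \<Rightarrow> ('a, 'r) ring_scheme \<Rightarrow> ('g \<Rightarrow> 'a \<Rightarrow> 'a) \<Rightarrow> ('g \<Rightarrow> 'a) \<Rightarrow> nat \<Rightarrow>
     ('g list \<Rightarrow> 'a) \<Rightarrow> 'g list \<Rightarrow> 'a" where
  "coboundary G A \<alpha> u n f =
     (\<lambda>xs\<in>tuples G (n + 1).
        \<alpha> (hd xs) (u (inv\<^bsub>G\<^esub> (hd xs)) \<otimes>\<^bsub>A\<^esub> f (tl xs))
        \<oplus>\<^bsub>A\<^esub> (\<Oplus>\<^bsub>A\<^esub>i\<in>{1..n}. [((- 1 :: int) ^ i)] \<cdot>\<^bsub>A\<^esub> (u (mprod G (take i xs)) \<otimes>\<^bsub>A\<^esub> f (merge_at G i xs)))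
        \<oplus>\<^bsub>A\<^esub> [((- 1 :: int) ^ (n + 1))] \<cdot>\<^bsub>A\<^esub> (u (mprod G xs) \<otimes>\<^bsub>A\<^esub> f (butlast xs)))"

definition cocycles ::
    "('g, 'm) monoid_scheme \<Rightarrow> ('a, 'r) ring_scheme \<Rightarrow> ('g \<Rightarrow> 'a \<Rightarrow> 'a) \<Rightarrow> ('g \<Rightarrow> 'a) \<Rightarrow> nat \<Rightarrow>
     ('g list \<Rightarrow> 'a) set" where
  "cocycles G A \<alpha> u n =
     {f \<in> cochains G A u n. coboundary G A \<alpha> u n f = (\<lambda>xs\<in>tuples G (n + 1). \<zero>\<^bsub>A\<^esub>)}"


section \<open>Transitive partial actions on products\<close>

definition transitive_action ::
    "('g, 'm) monoid_scheme \<Rightarrow> 'i set \<Rightarrow> ('i \<Rightarrow> ('k, 'a) module) \<Rightarrow>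
     ('g \<Rightarrow> ('i \<Rightarrow> 'a) set) \<Rightarrow> ('g \<Rightarrow> ('i \<Rightarrow> 'a) \<Rightarrow> ('i \<Rightarrow> 'a)) \<Rightarrow> bool" where
  "transitive_action G I A D \<alpha> \<longleftrightarrow>
     (\<forall>i\<in>I. \<forall>j\<in>I. \<exists>x\<in>carrier G.
        factor I A i \<subseteq> D (inv\<^bsub>G\<^esub> x) \<and> \<alpha> x ` factor I A i = factor I A j)"

definition factor_stabilizer ::
    "('g, 'm) monoid_scheme \<Rightarrow> 'i set \<Rightarrow> ('i \<Rightarrow> ('k, 'a) module) \<Rightarrow>
     ('g \<Rightarrow> ('i \<Rightarrow> 'a) set) \<Rightarrow> ('g \<Rightarrow> ('i \<Rightarrow> 'a) \<Rightarrow> ('i \<Rightarrow> 'a)) \<Rightarrow> 'i \<Rightarrow> 'g set" where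
  "factor_stabilizer G I A D \<alpha> l0 =
     {x \<in> carrier G. factor I A l0 \<subseteq> D (inv\<^bsub>G\<^esub> x) \<and> \<alpha> x ` factor I A l0 = factor I A l0}"

definition left_transversal :: "('g, 'm) monoid_scheme \<Rightarrow> 'g set \<Rightarrow> 'g set \<Rightarrow> bool" where
  "left_transversal G H T \<longleftrightarrow>
     T \<subseteq> carrier G \<and> (\<forall>x\<in>carrier G. \<exists>!t. t \<in> T \<and> x \<in> t <#\<^bsub>G\<^esub> H)"

definition coset_rep :: "('g, 'm) monoid_scheme \<Rightarrow> 'g set \<Rightarrow> 'g set \<Rightarrow> 'g \<Rightarrow> 'g" where
  "coset_rep G H T x = (THE t. t \<in> T \<and> x \<in> t <#\<^bsub>G\<^esub> H)"

text \<open>The subset of the transversal \<open>T\<close> with which the index set \<open>I\<close> is identified: \<open>g\<close> corresponds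
  to the index of the factor \<open>\<alpha>\<^sub>g(A\<^sub>1)\<close>, where \<open>A\<^sub>1\<close> is the factor with index \<open>l0\<close>.\<close>

definition index_reps ::
    "('g, 'm) monoid_scheme \<Rightarrow> 'i set \<Rightarrow> ('i \<Rightarrow> ('k, 'a) module) \<Rightarrow>
     ('g \<Rightarrow> ('i \<Rightarrow> 'a) set) \<Rightarrow> 'i \<Rightarrow> 'g set \<Rightarrow> 'g set" where
  "index_reps G I A D l0 T = {g \<in> T. factor I A l0 \<subseteq> D (inv\<^bsub>G\<^esub> g)}"

definition rep_of_index ::
    "('g, 'm) monoid_scheme \<Rightarrow> 'i set \<Rightarrow> ('i \<Rightarrow> ('k, 'a) module) \<Rightarrow>
     ('g \<Rightarrow> ('i \<Rightarrow> 'a) set) \<Rightarrow> ('g \<Rightarrow> ('i \<Rightarrow> 'a) \<Rightarrow> ('i \<Rightarrow> 'a)) \<Rightarrow> 'i \<Rightarrow> 'g set \<Rightarrow> 'i \<Rightarrow> 'g" where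
  "rep_of_index G I A D \<alpha> l0 T i =
     (THE g. g \<in> index_reps G I A D l0 T \<and> \<alpha> g ` factor I A l0 = factor I A i)"

text \<open>\<open>\<Prod>\<^sub>g a\<^sub>g\<close> for a family with \<open>a\<^sub>g \<in> \<alpha>\<^sub>g(A\<^sub>1)\<close>, indexed by \<^const>\<open>index_reps\<close>: the \<open>i\<close>-component of
  the result is the \<open>i\<close>-component of \<open>a\<^sub>g\<close>, where \<open>g\<close> is the element identified with \<open>i\<close> (all other
  components of \<open>a\<^sub>g\<close> are zero).\<close>

definition family_prod ::
    "('g, 'm) monoid_scheme \<Rightarrow> 'i set \<Rightarrow> ('i \<Rightarrow> ('k, 'a) module) \<Rightarrow>
     ('g \<Rightarrow> ('i \<Rightarrow> 'a) set) \<Rightarrow> ('g \<Rightarrow> ('i \<Rightarrow> 'a) \<Rightarrow> ('i \<Rightarrow> 'a)) \<Rightarrow> 'i \<Rightarrow> 'g set \<Rightarrow>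
     ('g \<Rightarrow> 'i \<Rightarrow> 'a) \<Rightarrow> 'i \<Rightarrow> 'a" where
  "family_prod G I A D \<alpha> l0 T a = (\<lambda>i\<in>I. a (rep_of_index G I A D \<alpha> l0 T i) i)"

definition theta ::
    "'i set \<Rightarrow> ('i \<Rightarrow> ('k, 'a) module) \<Rightarrow> ('g \<Rightarrow> ('i \<Rightarrow> 'a) \<Rightarrow> ('i \<Rightarrow> 'a)) \<Rightarrow> 'i \<Rightarrow>
     'g \<Rightarrow> ('i \<Rightarrow> 'a) \<Rightarrow> 'i \<Rightarrow> 'a" where
  "theta I A \<alpha> l0 g a = \<alpha> g (factor_one I A l0 \<otimes>\<^bsub>prod_algebra I A\<^esub> a)"


section \<open>The maps $\eta$, $\tau$ and $\sigma$\<close>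

definition eta :: "('g, 'm) monoid_scheme \<Rightarrow> 'g set \<Rightarrow> 'g set \<Rightarrow> 'g \<Rightarrow> 'g" where
  "eta G H T x = inv\<^bsub>G\<^esub> x \<otimes>\<^bsub>G\<^esub> coset_rep G H T x"

text \<open>\<open>x\<^sub>k\<^sup>-\<^sup>1 \<cdots> x\<^sub>1\<^sup>-\<^sup>1 g\<close> for \<open>xs = [x\<^sub>1, \<dots>, x\<^sub>k]\<close>.\<close>

definition back_translate :: "('g, 'm) monoid_scheme \<Rightarrow> 'g list \<Rightarrow> 'g \<Rightarrow> 'g" where
  "back_translate G xs g = mprod G (rev (map (\<lambda>x. inv\<^bsub>G\<^esub> x) xs)) \<otimes>\<^bsub>G\<^esub> g"

text \<open>In \<open>eta_tuple\<close>, \<open>tau\<close> and \<open>sigma\<close> the subscript \<open>n\<close> of \<open>\<eta>\<^sub>n\<^sup>g\<close>, \<open>\<tau>\<^sub>n\<^sup>g\<close> and \<open>\<sigma>\<^sub>n\<^sub>,\<^sub>i\<^sup>g\<close> is the length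
  of the list argument. The case \<open>n = 1\<close> of \<open>eta_tuple\<close> is not separate, as elements \<open>g\<close> of the
  transversal satisfy \<^term>\<open>coset_rep G H T g = g\<close>; in \<open>sigma\<close>, the cases \<open>0 < i < n\<close> and \<open>i = n > 0\<close>
  are merged, since \<open>drop n xs = []\<close>.\<close>

definition eta_tuple :: "('g, 'm) monoid_scheme \<Rightarrow> 'g set \<Rightarrow> 'g set \<Rightarrow> 'g \<Rightarrow> 'g list \<Rightarrow> 'g" where
  "eta_tuple G H T g xs =
     eta G H T (inv\<^bsub>G\<^esub> (last xs) \<otimes>\<^bsub>G\<^esub> coset_rep G H T (back_translate G (butlast xs) g))"

definition tau :: "('g, 'm) monoid_scheme \<Rightarrow> 'g set \<Rightarrow> 'g set \<Rightarrow> 'g \<Rightarrow> 'g list \<Rightarrow> 'g list" where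
  "tau G H T g xs = map (\<lambda>i. eta_tuple G H T g (take i xs)) [1..<Suc (length xs)]"

definition sigma :: "('g, 'm) monoid_scheme \<Rightarrow> 'g set \<Rightarrow> 'g set \<Rightarrow> nat \<Rightarrow> 'g \<Rightarrow> 'g list \<Rightarrow> 'g list" where
  "sigma G H T i g xs =
     (if i = 0 then inv\<^bsub>G\<^esub> g # xs
      else tau G H T g (take i xs)
           @ [inv\<^bsub>G\<^esub> (coset_rep G H T (back_translate G (take i xs) g))] @ drop i xs)"


section \<open>The cochains $w'$ and $\varepsilon$\<close>

definition w_prime ::
    "('g, 'm) monoid_scheme \<Rightarrow> 'i set \<Rightarrow> ('i \<Rightarrow> ('k, 'a) module) \<Rightarrow>
     ('g \<Rightarrow> ('i \<Rightarrow> 'a) set) \<Rightarrow> ('g \<Rightarrow> ('i \<Rightarrow> 'a) \<Rightarrow> ('i \<Rightarrow> 'a)) \<Rightarrow> ('g \<Rightarrow> 'i \<Rightarrow> 'a) \<Rightarrow> 'i \<Rightarrow> 'g set \<Rightarrow>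
     nat \<Rightarrow> ('g list \<Rightarrow> 'i \<Rightarrow> 'a) \<Rightarrow> 'g list \<Rightarrow> 'i \<Rightarrow> 'a" where
  "w_prime G I A D \<alpha> u l0 T n w =
     (\<lambda>xs\<in>tuples G n.
        tuple_unit G (prod_algebra I A) u xs \<otimes>\<^bsub>prod_algebra I A\<^esub>
        family_prod G I A D \<alpha> l0 T
          (\<lambda>g. theta I A \<alpha> l0 g (w (tau G (factor_stabilizer G I A D \<alpha> l0) T g xs))))"

text \<open>For \<open>n = 1\<close> the only argument is \<open>[]\<close>, and the value is \<open>\<Prod>\<^sub>g \<theta>\<^sub>g(w(g\<^sup>-\<^sup>1))\<close>.\<close>

definition epsilon ::
    "('g, 'm) monoid_scheme \<Rightarrow> 'i set \<Rightarrow> ('i \<Rightarrow> ('k, 'a) module) \<Rightarrow>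
     ('g \<Rightarrow> ('i \<Rightarrow> 'a) set) \<Rightarrow> ('g \<Rightarrow> ('i \<Rightarrow> 'a) \<Rightarrow> ('i \<Rightarrow> 'a)) \<Rightarrow> ('g \<Rightarrow> 'i \<Rightarrow> 'a) \<Rightarrow> 'i \<Rightarrow> 'g set \<Rightarrow>
     nat \<Rightarrow> ('g list \<Rightarrow> 'i \<Rightarrow> 'a) \<Rightarrow> 'g list \<Rightarrow> 'i \<Rightarrow> 'a" where
  "epsilon G I A D \<alpha> u l0 T n w =
     (\<lambda>xs\<in>tuples G (n - 1).
        tuple_unit G (prod_algebra I A) u xs \<otimes>\<^bsub>prod_algebra I A\<^esub>
        family_prod G I A D \<alpha> l0 T
          (\<lambda>g. theta I A \<alpha> l0 g
             (\<Oplus>\<^bsub>prod_algebra I A\<^esub>i\<in>{0..n - 1}.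
                [((- 1 :: int) ^ i)] \<cdot>\<^bsub>prod_algebra I A\<^esub>
                w (sigma G (factor_stabilizer G I A D \<alpha> l0) T i g xs))))"

end

theory Submission
  imports Defs
begin

text \<open>By indecomposability, the components of \<open>1\<^sub>x\<close> are 0 or 1, so the partial action permutes the
  factors. Let \<open>S\<close> be the set of \<open>y \<in> G\<close> with \<open>A\<^sub>1 \<subseteq> D(y\<^sup>-\<^sup>1)\<close>; it is a union of left cosets of
  \<open>H\<close>. Pulling the factor \<open>\<alpha>\<^sub>y(A\<^sub>1)\<close> back to \<open>A\<^sub>1\<close> gives ring homomorphisms \<open>\<phi>\<^sub>y : A \<rightarrow> A\<^sub>1\<close>, and
  \<open>f \<mapsto> F\<close> with \<open>F(y\<^sub>0, \<dots>, y\<^sub>n) = \<phi>(f(y\<^sub>0 y\<^sub>1\<^sup>-\<^sup>1, \<dots>, y\<^sub>n\<^sub>-\<^sub>1 y\<^sub>n\<^sup>-\<^sup>1))\<close>, \<open>\<phi>\<close> taken at \<open>y\<^sub>0\<close>, identifies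
  partial cochains with \<open>H\<close>-equivariant functions on \<open>S\<^sup>n\<^sup>+\<^sup>1\<close> and \<open>\<delta>\<close> with the simplicial
  coboundary. In this picture \<open>w'\<close> is the pullback of \<open>w\<close> along the \<open>H\<close>-equivariant retraction
  \<open>S \<rightarrow> H\<close>, \<open>y \<mapsto> \<eta>(y)\<^sup>-\<^sup>1\<close>, and \<open>\<epsilon>\<close> is given by the prism operator between this retraction and the
  identity, so that \<open>w = \<delta>\<epsilon> + w'\<close> is the standard chain homotopy formula.\<close>

section \<open>Face and prism sums\<close>

text \<open>The recursions over the list replace alternating double sums: both operators commute with
  fixing the first argument up to one correction term, and the homotopy formula becomes an
  induction.\<close>

fun face_sum :: "('a, 'r) ring_scheme \<Rightarrow> ('y list \<Rightarrow> 'a) \<Rightarrow> 'y list \<Rightarrow> 'a" where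
  "face_sum R F [] = \<zero>\<^bsub>R\<^esub>"
| "face_sum R F (y # ys) = F ys \<ominus>\<^bsub>R\<^esub> face_sum R (\<lambda>zs. F (y # zs)) ys"

fun prism_sum ::
    "('a, 'r) ring_scheme \<Rightarrow> ('y \<Rightarrow> 'y) \<Rightarrow> ('y list \<Rightarrow> 'a) \<Rightarrow> 'y list \<Rightarrow> 'a" where
  "prism_sum R r F [] = \<zero>\<^bsub>R\<^esub>"
| "prism_sum R r F (y # ys) =
     F (r y # y # ys) \<ominus>\<^bsub>R\<^esub> prism_sum R r (\<lambda>zs. F (r y # zs)) ys"

definition omit :: "nat \<Rightarrow> 'y list \<Rightarrow> 'y list" where
  "omit i ys = take i ys @ drop (Suc i) ys"

text \<open>The \<open>i\<close>-th simplex of the prism over \<open>ys\<close>: the vertices up to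
  \<open>ys ! i\<close> moved by \<open>r\<close>, followed by those from \<open>ys ! i\<close> on
  unmoved, so that this vertex occurs in both forms.\<close>

definition prism :: "('y \<Rightarrow> 'y) \<Rightarrow> nat \<Rightarrow> 'y list \<Rightarrow> 'y list" where
  "prism r i ys = map r (take (Suc i) ys) @ drop i ys"

context abelian_group
begin

lemma neg_zero: "\<ominus> \<zero> = \<zero>"
  using r_neg[of \<zero>] by simp

lemma sign_add_pow:
  assumes "a \<in> carrier G"
  shows "[((- 1 :: int) ^ i)] \<cdot> a = (if even i then a else \<ominus> a)"
  using assms add.int_pow_neg[of a 1] by (simp add: add.int_pow_1)

lemma sign_add_pow_closed [simp]:
  "a \<in> carrier G \<Longrightarrow> [((- 1 :: int) ^ i)] \<cdot> a \<in> carrier G"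
  by (simp add: sign_add_pow)

text \<open>Shifting the index by one flips every sign. Peeling off the lowest index matches the
  recursions of \<open>face_sum\<close> and \<open>prism_sum\<close>, whereas
  \<open>finsum_Suc\<close> peels off the highest one.\<close>

lemma alternating_sum_Suc:
  assumes "\<And>i. f i \<in> carrier G"
  shows "(\<Oplus>i\<in>{..Suc n}. [((- 1 :: int) ^ i)] \<cdot> f i) =
    f 0 \<ominus> (\<Oplus>i\<in>{..n}. [((- 1 :: int) ^ i)] \<cdot> f (Suc i))"
proof (induction n)
  case 0
  show ?case
    using assms by (simp add: finsum_Suc finsum_0 sign_add_pow a_minus_def a_comm)
next
  case (Suc n)
  have c: "(\<Oplus>i\<in>{..n}. [((- 1 :: int) ^ i)] \<cdot> f (Suc i)) \<in> carrier G" (is "?s \<in> _")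
    using assms by (intro finsum_closed) auto
  have "(\<Oplus>i\<in>{..Suc (Suc n)}. [((- 1 :: int) ^ i)] \<cdot> f i) =
      [((- 1 :: int) ^ Suc (Suc n))] \<cdot> f (Suc (Suc n)) \<oplus> (f 0 \<ominus> ?s)"
    using assms Suc.IH by (subst finsum_Suc) auto
  also have "\<dots> = f 0 \<ominus> ([((- 1 :: int) ^ Suc n)] \<cdot> f (Suc (Suc n)) \<oplus> ?s)"
    using assms c by (simp add: sign_add_pow a_minus_def minus_add a_ac del: power_Suc)
  also have "[((- 1 :: int) ^ Suc n)] \<cdot> f (Suc (Suc n)) \<oplus> ?s =
      (\<Oplus>i\<in>{..Suc n}. [((- 1 :: int) ^ i)] \<cdot> f (Suc i))"
    using assms by (subst finsum_Suc) auto
  finally show ?case .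
qed

lemma face_sum_closed [simp]:
  "(\<And>zs. F zs \<in> carrier G) \<Longrightarrow> face_sum G F ys \<in> carrier G"
  by (induction ys arbitrary: F) auto

lemma prism_sum_closed [simp]:
  "(\<And>zs. F zs \<in> carrier G) \<Longrightarrow> prism_sum G r F ys \<in> carrier G"
  by (induction ys arbitrary: F) auto

text \<open>Omitting entry 0 leaves the tail; every other omission keeps the head, so the remaining
  terms form the face sum with the first argument fixed.\<close>

lemma face_sum_eq_finsum:
  assumes "\<And>zs. F zs \<in> carrier G" "length ys = Suc n"
  shows "face_sum G F ys = (\<Oplus>i\<in>{..n}. [((- 1 :: int) ^ i)] \<cdot> F (omit i ys))"
  using assms
proof (induction n arbitrary: F ys)
  case 0
  then obtain y where "ys = [y]" by (auto simp: length_Suc_conv)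
  with 0 show ?case by (simp add: omit_def finsum_0 a_minus_def sign_add_pow)
next
  case (Suc n)
  from Suc.prems(2) obtain y zs where ys: "ys = y # zs" "length zs = Suc n"
    by (auto simp: length_Suc_conv)
  show ?case
    unfolding ys(1) using Suc.IH[of "\<lambda>us. F (y # us)" zs] Suc.prems ys(2)
    by (subst alternating_sum_Suc) (simp_all add: omit_def)
qed

lemma prism_sum_eq_finsum:
  assumes "\<And>zs. F zs \<in> carrier G" "length ys = Suc n"
  shows "prism_sum G r F ys = (\<Oplus>i\<in>{..n}. [((- 1 :: int) ^ i)] \<cdot> F (prism r i ys))"
  using assms
proof (induction n arbitrary: F ys)
  case 0
  then obtain y where "ys = [y]" by (auto simp: length_Suc_conv)
  with 0 show ?case by (simp add: prism_def finsum_0 a_minus_def sign_add_pow)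
next
  case (Suc n)
  from Suc.prems(2) obtain y zs where ys: "ys = y # zs" "length zs = Suc n"
    by (auto simp: length_Suc_conv)
  show ?case
    unfolding ys(1) using Suc.IH[of "\<lambda>us. F (r y # us)" zs] Suc.prems ys(2)
    by (subst alternating_sum_Suc) (simp_all add: prism_def)
qed

lemma face_sum_diff:
  assumes "\<And>zs. F zs \<in> carrier G" "\<And>zs. F' zs \<in> carrier G"
  shows "face_sum G (\<lambda>zs. F zs \<ominus> F' zs) ys = face_sum G F ys \<ominus> face_sum G F' ys"
  using assms
  by (induction ys arbitrary: F F') (simp_all add: a_minus_def minus_add a_ac neg_zero)

lemma prism_sum_diff:
  assumes "\<And>zs. F zs \<in> carrier G" "\<And>zs. F' zs \<in> carrier G"
  shows "prism_sum G r (\<lambda>zs. F zs \<ominus> F' zs) ys = prism_sum G r F ys \<ominus> prism_sum G r F' ys"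
  using assms
  by (induction ys arbitrary: F F') (simp_all add: a_minus_def minus_add a_ac neg_zero)

text \<open>Omitting an entry commutes with moving all vertices by \<open>r\<close>. This naturality
  later carries the cocycle condition from \<open>w\<close> to \<open>w'\<close>.\<close>

lemma face_sum_map: "face_sum G (\<lambda>zs. F (map r zs)) ys = face_sum G F (map r ys)"
proof (induction ys arbitrary: F)
  case (Cons y ys)
  show ?case using Cons.IH[of "\<lambda>zs. F (r y # zs)"] by simp
qed simp

lemma face_sum_cong:
  assumes "\<And>zs. set zs \<subseteq> S \<Longrightarrow> length zs + 1 = length ys \<Longrightarrow> F zs = F' zs" "set ys \<subseteq> S"
  shows "face_sum G F ys = face_sum G F' ys"
  using assms
proof (induction ys arbitrary: F F')
  case (Cons y ys)
  have "face_sum G (\<lambda>zs. F (y # zs)) ys = face_sum G (\<lambda>zs. F' (y # zs)) ys"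
    by (rule Cons.IH) (use Cons.prems in auto)
  with Cons.prems show ?case by simp
qed simp

text \<open>Prisms over lists in \<open>S\<close> have their vertices in \<open>S\<close>. For
  \<open>F\<close> the face sum of a cocycle, known to vanish on lists over \<open>S\<close>, this
  removes the second homotopy term.\<close>

lemma prism_sum_eq_zero:
  assumes "\<And>zs. set zs \<subseteq> S \<Longrightarrow> length zs = length ys + 1 \<Longrightarrow> F zs = \<zero>"
    "set ys \<subseteq> S" "r ` S \<subseteq> S"
  shows "prism_sum G r F ys = \<zero>"
  using assms
proof (induction ys arbitrary: F)
  case (Cons y ys)
  have "prism_sum G r (\<lambda>zs. F (r y # zs)) ys = \<zero>"
    by (rule Cons.IH) (use Cons.prems in auto)
  moreover have "F (r y # y # ys) = \<zero>"
    using Cons.prems by auto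
  ultimately show ?case by (simp add: a_minus_def)
qed simp

text \<open>The chain homotopy between the identity and the map induced by \<open>r\<close>. The
  induction hypothesis is used for \<open>F\<close> with its first argument fixed to
  \<open>r y\<close>.\<close>

theorem face_prism_homotopy:
  assumes "\<And>zs. F zs \<in> carrier G"
  shows "face_sum G (prism_sum G r F) ys \<oplus> prism_sum G r (face_sum G F) ys =
    F ys \<ominus> F (map r ys)"
  using assms
proof (induction ys arbitrary: F)
  case Nil
  then show ?case by (simp add: a_minus_def r_neg)
next
  case (Cons y ys)
  let ?F = "\<lambda>zs. F (r y # zs)" and ?E = "\<lambda>zs. F (r y # y # zs)"
  note [simp] = Cons.prems
  have f: "face_sum G (prism_sum G r F) (y # ys) =
      prism_sum G r F ys \<ominus> (face_sum G ?E ys \<ominus> face_sum G (prism_sum G r ?F) ys)"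
    by (simp add: face_sum_diff)
  have p: "prism_sum G r (face_sum G F) (y # ys) =
      F (y # ys) \<ominus> (F (r y # ys) \<ominus> face_sum G ?E ys)
      \<ominus> (prism_sum G r F ys \<ominus> prism_sum G r (face_sum G ?F) ys)"
    by (simp add: prism_sum_diff)
  \<comment> \<open>\<open>P\<close> is the prism sum of \<open>F\<close> over the tail and
    \<open>E\<close> the face sum with \<open>r y\<close> and \<open>y\<close> fixed; both occur
    twice with opposite signs. \<open>h\<close> is the induction hypothesis, \<open>Y\<close> and
    \<open>Z\<close> being the values of \<open>F\<close> at \<open>r y # ys\<close> and
    \<open>r y # map r ys\<close>.\<close>
  have cancel: "P \<ominus> (E \<ominus> A) \<oplus> (X \<ominus> (Y \<ominus> E) \<ominus> (P \<ominus> B)) = X \<ominus> Z"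
    if c: "P \<in> carrier G" "E \<in> carrier G" "A \<in> carrier G" "B \<in> carrier G" "X \<in> carrier G"
      "Y \<in> carrier G" "Z \<in> carrier G" and h: "A \<oplus> B = Y \<ominus> Z" for P E A B X Y Z
  proof -
    have "P \<ominus> (E \<ominus> A) \<oplus> (X \<ominus> (Y \<ominus> E) \<ominus> (P \<ominus> B)) =
        (P \<oplus> \<ominus> P) \<oplus> ((E \<oplus> \<ominus> E) \<oplus> (X \<oplus> ((A \<oplus> B) \<ominus> Y)))"
      using c by (simp add: a_minus_def minus_add a_ac del: add.r_inv)
    also have "\<dots> = X \<oplus> ((A \<oplus> B) \<ominus> Y)"
      using c by (simp add: r_neg)
    also have "\<dots> = X \<ominus> Z"
      unfolding h using c by (simp add: a_minus_def a_comm[of Y] a_assoc l_neg)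
    finally show ?thesis .
  qed
  show ?case
    unfolding f p list.map(2)
    by (rule cancel) (use Cons.IH[of ?F] in simp_all)
qed

end

section \<open>Partial representations by ring endomorphisms\<close>

context ring
begin

lemma central_idempotent_mult_mult:
  assumes "central_idempotent R c" "a \<in> carrier R" "b \<in> carrier R"
  shows "c \<otimes> a \<otimes> (c \<otimes> b) = c \<otimes> (a \<otimes> b)"
proof -
  have c: "c \<in> carrier R" "c \<otimes> c = c" "a \<otimes> c = c \<otimes> a"
    using assms unfolding central_idempotent_def by metis+
  have "c \<otimes> a \<otimes> (c \<otimes> b) = c \<otimes> (a \<otimes> c) \<otimes> b"
    using assms c(1) by (simp add: m_assoc)
  also have "\<dots> = c \<otimes> c \<otimes> (a \<otimes> b)"
    unfolding c(3) using assms c(1) by (simp add: m_assoc)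
  finally show ?thesis by (simp only: c(2))
qed

lemma central_idempotent_mult:
  assumes "central_idempotent R c" "central_idempotent R d"
  shows "central_idempotent R (c \<otimes> d)"
  unfolding central_idempotent_def
proof (intro conjI ballI)
  have c: "c \<in> carrier R" "\<And>a. a \<in> carrier R \<Longrightarrow> c \<otimes> a = a \<otimes> c"
    using assms unfolding central_idempotent_def by blast+
  have d: "d \<in> carrier R" "d \<otimes> d = d" "\<And>a. a \<in> carrier R \<Longrightarrow> d \<otimes> a = a \<otimes> d"
    using assms unfolding central_idempotent_def by blast+
  show "c \<otimes> d \<in> carrier R" "c \<otimes> d \<otimes> (c \<otimes> d) = c \<otimes> d"
    using assms c(1) d(1,2) by (simp_all add: central_idempotent_mult_mult)
  show "c \<otimes> d \<otimes> a = a \<otimes> (c \<otimes> d)" if "a \<in> carrier R" for a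
  proof -
    have "c \<otimes> d \<otimes> a = c \<otimes> a \<otimes> d"
      using that c(1) d(1) d(3)[OF that] by (simp add: m_assoc)
    then show ?thesis
      using that c(1) d(1) c(2)[OF that] by (simp add: m_assoc)
  qed
qed

end

text \<open>Here \<open>\<beta> g a\<close> stands for \<open>\<alpha>\<^sub>g(1 a)\<close> with the unit \<open>1\<close> of the domain of \<open>\<alpha>\<^sub>g\<close>, a total map.\<close>

locale unital_partial_rep = G: group G + R: ring R
  for G :: "('g, 'm) monoid_scheme" (structure) and R :: "('a, 'r) ring_scheme" (structure) +
  fixes \<beta> :: "'g \<Rightarrow> 'a \<Rightarrow> 'a" and u :: "'g \<Rightarrow> 'a"
  assumes \<beta>_closed [simp]:
      "\<lbrakk>g \<in> carrier G; a \<in> carrier R\<rbrakk> \<Longrightarrow> \<beta> g a \<in> carrier R"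
    and \<beta>_add:
      "\<lbrakk>g \<in> carrier G; a \<in> carrier R; b \<in> carrier R\<rbrakk> \<Longrightarrow> \<beta> g (a \<oplus>\<^bsub>R\<^esub> b) = \<beta> g a \<oplus>\<^bsub>R\<^esub> \<beta> g b"
    and \<beta>_mult:
      "\<lbrakk>g \<in> carrier G; a \<in> carrier R; b \<in> carrier R\<rbrakk> \<Longrightarrow> \<beta> g (a \<otimes>\<^bsub>R\<^esub> b) = \<beta> g a \<otimes>\<^bsub>R\<^esub> \<beta> g b"
    and \<beta>_unit: "a \<in> carrier R \<Longrightarrow> \<beta> \<one> a = a"
    and \<beta>_one: "g \<in> carrier G \<Longrightarrow> \<beta> g \<one>\<^bsub>R\<^esub> = u g"
    and \<beta>_comp:
      "\<lbrakk>g \<in> carrier G; h \<in> carrier G; a \<in> carrier R\<rbrakk> \<Longrightarrow>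
        \<beta> g (\<beta> h a) = u g \<otimes>\<^bsub>R\<^esub> \<beta> (g \<otimes> h) a"
    and u_central_idempotent: "g \<in> carrier G \<Longrightarrow> central_idempotent R (u g)"
begin

lemma u_closed [simp]: "g \<in> carrier G \<Longrightarrow> u g \<in> carrier R"
  using u_central_idempotent by (simp add: central_idempotent_def)

lemma u_comm: "\<lbrakk>g \<in> carrier G; a \<in> carrier R\<rbrakk> \<Longrightarrow> a \<otimes>\<^bsub>R\<^esub> u g = u g \<otimes>\<^bsub>R\<^esub> a"
  using u_central_idempotent[of g] unfolding central_idempotent_def by metis

lemma u_mult_\<beta> [simp]:
  "\<lbrakk>g \<in> carrier G; a \<in> carrier R\<rbrakk> \<Longrightarrow> u g \<otimes>\<^bsub>R\<^esub> \<beta> g a = \<beta> g a"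
  using \<beta>_mult[of g "\<one>\<^bsub>R\<^esub>" a] by (simp add: \<beta>_one)

lemma \<beta>_u: "\<lbrakk>g \<in> carrier G; h \<in> carrier G\<rbrakk> \<Longrightarrow> \<beta> g (u h) = u g \<otimes>\<^bsub>R\<^esub> u (g \<otimes> h)"
  using \<beta>_comp[of g h "\<one>\<^bsub>R\<^esub>"] by (simp add: \<beta>_one)

lemma \<beta>_\<beta>_inv: "\<lbrakk>g \<in> carrier G; a \<in> carrier R\<rbrakk> \<Longrightarrow> \<beta> g (\<beta> (inv g) a) = u g \<otimes>\<^bsub>R\<^esub> a"
  by (simp add: \<beta>_comp \<beta>_unit)

lemma \<beta>_inv_\<beta>: "\<lbrakk>g \<in> carrier G; a \<in> carrier R\<rbrakk> \<Longrightarrow> \<beta> (inv g) (\<beta> g a) = u (inv g) \<otimes>\<^bsub>R\<^esub> a"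
  by (simp add: \<beta>_comp \<beta>_unit)

text \<open>As \<open>\<beta> g c\<close> absorbs \<open>u g\<close>, the factor \<open>a\<close>
  may be replaced by \<open>u g\<close> times \<open>a\<close>, which is
  \<open>\<beta> g (\<beta> (inv g) a)\<close>.\<close>

lemma \<beta>_mult_left:
  "\<lbrakk>g \<in> carrier G; c \<in> carrier R; a \<in> carrier R\<rbrakk> \<Longrightarrow> \<beta> g c \<otimes>\<^bsub>R\<^esub> a = \<beta> g (c \<otimes>\<^bsub>R\<^esub> \<beta> (inv g) a)"
  by (simp add: \<beta>_mult \<beta>_\<beta>_inv u_comm flip: R.m_assoc)

lemma \<beta>_mult_right:
  "\<lbrakk>g \<in> carrier G; c \<in> carrier R; a \<in> carrier R\<rbrakk> \<Longrightarrow> a \<otimes>\<^bsub>R\<^esub> \<beta> g c = \<beta> g (\<beta> (inv g) a \<otimes>\<^bsub>R\<^esub> c)"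
  by (simp add: \<beta>_mult \<beta>_\<beta>_inv u_comm[symmetric, of g a] R.m_assoc)

text \<open>\<open>\<beta> g\<close> need not be surjective, so centrality is not inherited at once;
  an arbitrary factor \<open>a\<close> is first pulled inside \<open>\<beta> g\<close>, where
  \<open>c\<close> commutes with it.\<close>

lemma \<beta>_central_idempotent:
  assumes "g \<in> carrier G" "central_idempotent R c"
  shows "central_idempotent R (\<beta> g c)"
  unfolding central_idempotent_def
proof (intro conjI ballI)
  have c: "c \<in> carrier R" "c \<otimes>\<^bsub>R\<^esub> c = c" "\<And>a. a \<in> carrier R \<Longrightarrow> c \<otimes>\<^bsub>R\<^esub> a = a \<otimes>\<^bsub>R\<^esub> c"
    using assms(2) unfolding central_idempotent_def by blast+
  show "\<beta> g c \<in> carrier R" "\<beta> g c \<otimes>\<^bsub>R\<^esub> \<beta> g c = \<beta> g c"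
    using assms(1) c(1,2) by (simp_all flip: \<beta>_mult)
  show "\<beta> g c \<otimes>\<^bsub>R\<^esub> a = a \<otimes>\<^bsub>R\<^esub> \<beta> g c" if "a \<in> carrier R" for a
    using assms(1) c(1) c(3)[of "\<beta> (inv g) a"] that
    by (simp add: \<beta>_mult_left[of g c a] \<beta>_mult_right[of g c a])
qed

lemma u_one: "u \<one> = \<one>\<^bsub>R\<^esub>"
  by (simp add: \<beta>_unit flip: \<beta>_one)

lemma \<beta>_zero [simp]: "g \<in> carrier G \<Longrightarrow> \<beta> g \<zero>\<^bsub>R\<^esub> = \<zero>\<^bsub>R\<^esub>"
  using \<beta>_add[of g "\<zero>\<^bsub>R\<^esub>" "\<zero>\<^bsub>R\<^esub>"] by (simp add: R.add.l_cancel_one')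

end

section \<open>Coordinates given by a primitive central idempotent\<close>

locale based_partial_rep = unital_partial_rep G R \<beta> u
  for G :: "('g, 'm) monoid_scheme" (structure) and R :: "('a, 'r) ring_scheme" (structure)
    and \<beta> u +
  fixes e :: 'a
  assumes e_central_idempotent: "central_idempotent R e"
    and e_nonzero: "e \<noteq> \<zero>\<^bsub>R\<^esub>"
    and e_primitive:
      "\<lbrakk>central_idempotent R c; e \<otimes>\<^bsub>R\<^esub> c = c\<rbrakk> \<Longrightarrow> c = \<zero>\<^bsub>R\<^esub> \<or> c = e"
begin

text \<open>With \<open>e\<close> the unit of the base factor, this is the set \<open>S\<close>: the
  condition says that the ideal of \<open>u (inv g)\<close> contains the base factor.\<close>

definition base_dom :: "'g set" where
  "base_dom = {g \<in> carrier G. e \<otimes>\<^bsub>R\<^esub> u (inv g) = e}"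

text \<open>The subgroup \<open>H\<close>. The form symmetric in \<open>g\<close> and
  \<open>inv g\<close> makes closure under inverses immediate; \<open>base_stab_iff\<close> recovers
  the condition \<open>\<beta> g e = e\<close>.\<close>

definition base_stab :: "'g set" where
  "base_stab = {g \<in> carrier G. e \<otimes>\<^bsub>R\<^esub> \<beta> g e = e \<and> e \<otimes>\<^bsub>R\<^esub> \<beta> (inv g) e = e}"

text \<open>The map \<open>\<phi>\<^sub>g\<close> into the ideal of \<open>e\<close>; it vanishes identically for \<open>g\<close> outside \<open>base_dom\<close>.\<close>

definition coord :: "'g \<Rightarrow> 'a \<Rightarrow> 'a" where
  "coord g a = e \<otimes>\<^bsub>R\<^esub> \<beta> (inv g) a"

lemma e_closed [simp]: "e \<in> carrier R"
  and e_idem [simp]: "e \<otimes>\<^bsub>R\<^esub> e = e"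
  and e_comm: "a \<in> carrier R \<Longrightarrow> a \<otimes>\<^bsub>R\<^esub> e = e \<otimes>\<^bsub>R\<^esub> a"
  using e_central_idempotent unfolding central_idempotent_def by metis+

lemma e_e_mult [simp]: "a \<in> carrier R \<Longrightarrow> e \<otimes>\<^bsub>R\<^esub> (e \<otimes>\<^bsub>R\<^esub> a) = e \<otimes>\<^bsub>R\<^esub> a"
  by (simp flip: R.m_assoc)

lemma base_dom_carrier: "g \<in> base_dom \<Longrightarrow> g \<in> carrier G"
  by (simp add: base_dom_def)

lemma base_stab_carrier: "g \<in> base_stab \<Longrightarrow> g \<in> carrier G"
  by (simp add: base_stab_def)

text \<open>The product is a central idempotent below \<open>e\<close>, so primitivity leaves only
  \<open>e\<close> and zero. The inverse appears because \<open>base_dom\<close> tests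
  \<open>u\<close> at the inverse.\<close>

lemma e_mult_u:
  assumes g: "g \<in> carrier G"
  shows "e \<otimes>\<^bsub>R\<^esub> u g = (if inv g \<in> base_dom then e else \<zero>\<^bsub>R\<^esub>)"
proof -
  have "central_idempotent R (e \<otimes>\<^bsub>R\<^esub> u g)"
    using g e_central_idempotent u_central_idempotent by (simp add: R.central_idempotent_mult)
  then have "e \<otimes>\<^bsub>R\<^esub> u g = \<zero>\<^bsub>R\<^esub> \<or> e \<otimes>\<^bsub>R\<^esub> u g = e"
    by (rule e_primitive) (use g in simp)
  then show ?thesis
    using g e_nonzero by (cases "e \<otimes>\<^bsub>R\<^esub> u g = e") (simp_all add: base_dom_def)
qed

lemma one_in_base_dom: "\<one> \<in> base_dom"
  by (simp add: base_dom_def \<beta>_unit flip: \<beta>_one)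

lemma coord_closed [simp]:
  "\<lbrakk>g \<in> carrier G; a \<in> carrier R\<rbrakk> \<Longrightarrow> coord g a \<in> carrier R"
  by (simp add: coord_def)

lemma e_coord [simp]:
  "\<lbrakk>g \<in> carrier G; a \<in> carrier R\<rbrakk> \<Longrightarrow> e \<otimes>\<^bsub>R\<^esub> coord g a = coord g a"
  by (simp add: coord_def)

lemma coord_add:
  "\<lbrakk>g \<in> carrier G; a \<in> carrier R; b \<in> carrier R\<rbrakk> \<Longrightarrow>
    coord g (a \<oplus>\<^bsub>R\<^esub> b) = coord g a \<oplus>\<^bsub>R\<^esub> coord g b"
  by (simp add: coord_def \<beta>_add R.r_distr)

lemma coord_zero [simp]: "g \<in> carrier G \<Longrightarrow> coord g \<zero>\<^bsub>R\<^esub> = \<zero>\<^bsub>R\<^esub>"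
  by (simp add: coord_def)

lemma coord_mult:
  assumes "g \<in> carrier G" "a \<in> carrier R" "b \<in> carrier R"
  shows "coord g (a \<otimes>\<^bsub>R\<^esub> b) = coord g a \<otimes>\<^bsub>R\<^esub> coord g b"
  using assms e_central_idempotent by (simp add: coord_def \<beta>_mult R.central_idempotent_mult_mult)

lemma coord_a_inv:
  assumes "g \<in> carrier G" "a \<in> carrier R"
  shows "coord g (\<ominus>\<^bsub>R\<^esub> a) = \<ominus>\<^bsub>R\<^esub> coord g a"
  using assms coord_add[of g "\<ominus>\<^bsub>R\<^esub> a" a]
  by (intro R.minus_equality[symmetric]) (simp_all add: R.l_neg)

lemma coord_sign:
  assumes "g \<in> carrier G" "a \<in> carrier R"
  shows "coord g ([((- 1 :: int) ^ i)] \<cdot>\<^bsub>R\<^esub> a) = [((- 1 :: int) ^ i)] \<cdot>\<^bsub>R\<^esub> coord g a"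
  using assms by (simp add: R.sign_add_pow coord_a_inv)

lemma coord_finsum:
  assumes "g \<in> carrier G" "f \<in> X \<rightarrow> carrier R"
  shows "coord g (finsum R f X) = finsum R (\<lambda>i. coord g (f i)) X"
proof (cases "finite X")
  case True
  then show ?thesis using assms(2)
  proof (induction X rule: finite_induct)
    case (insert x X)
    then have "f \<in> X \<rightarrow> carrier R" "f x \<in> carrier R" by auto
    moreover have "(\<lambda>i. coord g (f i)) \<in> X \<rightarrow> carrier R"
      using \<open>f \<in> X \<rightarrow> carrier R\<close> assms(1) by (auto simp: Pi_iff)
    ultimately show ?case
      using insert assms(1) by (simp add: R.finsum_insert coord_add R.finsum_closed)
  qed (use assms in simp)
qed (use assms in \<open>simp add: R.finsum_infinite\<close>)

lemma coord_outside:
  assumes "g \<in> carrier G" "g \<notin> base_dom" "a \<in> carrier R"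
  shows "coord g a = \<zero>\<^bsub>R\<^esub>"
proof -
  have "coord g a = e \<otimes>\<^bsub>R\<^esub> u (inv g) \<otimes>\<^bsub>R\<^esub> \<beta> (inv g) a"
    using assms by (simp add: coord_def R.m_assoc)
  then show ?thesis using assms by (simp add: e_mult_u)
qed

text \<open>The correction factor \<open>u (inv g)\<close> of the composition law is absorbed by
  \<open>e\<close>, as \<open>g\<close> lies in \<open>base_dom\<close>. If
  \<open>inv x \<otimes> g\<close> lies outside, both sides vanish by
  \<open>coord_outside\<close>.\<close>

lemma coord_\<beta>:
  assumes "g \<in> base_dom" "x \<in> carrier G" "a \<in> carrier R"
  shows "coord g (\<beta> x a) = coord (inv x \<otimes> g) a"
proof -
  have g: "g \<in> carrier G" by (rule base_dom_carrier) fact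
  have "coord g (\<beta> x a) = e \<otimes>\<^bsub>R\<^esub> u (inv g) \<otimes>\<^bsub>R\<^esub> \<beta> (inv g \<otimes> x) a"
    using assms g by (simp add: coord_def \<beta>_comp R.m_assoc)
  also have "\<dots> = coord (inv x \<otimes> g) a"
    using assms g by (simp add: e_mult_u coord_def G.inv_mult_group)
  finally show ?thesis .
qed

lemma coord_u:
  assumes "g \<in> base_dom" "x \<in> carrier G"
  shows "coord g (u x) = (if inv x \<otimes> g \<in> base_dom then e else \<zero>\<^bsub>R\<^esub>)"
proof -
  have g: "g \<in> carrier G" by (rule base_dom_carrier) fact
  have "coord g (u x) = coord (inv x \<otimes> g) \<one>\<^bsub>R\<^esub>"
    using assms coord_\<beta>[of g x "\<one>\<^bsub>R\<^esub>"] by (simp add: \<beta>_one)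
  then show ?thesis
    using assms g by (simp add: coord_def \<beta>_one e_mult_u)
qed

text \<open>In coordinates the domain idempotents become membership conditions for
  \<open>base_dom\<close>, by the dichotomy \<open>e_mult_u\<close>.\<close>

lemma coord_u_mult:
  assumes "g \<in> base_dom" "x \<in> carrier G" "a \<in> carrier R"
  shows "coord g (u x \<otimes>\<^bsub>R\<^esub> a) = (if inv x \<otimes> g \<in> base_dom then coord g a else \<zero>\<^bsub>R\<^esub>)"
  using assms by (simp add: coord_mult coord_u base_dom_carrier)

lemma coord_unit: "a \<in> carrier R \<Longrightarrow> coord \<one> a = e \<otimes>\<^bsub>R\<^esub> a"
  by (simp add: coord_def \<beta>_unit)

text \<open>Recovers from the coordinate at \<open>g\<close> the component of \<open>a\<close> in
  the factor with unit \<open>\<beta> g e\<close>; the separation of elements by coordinates rests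
  on this.\<close>

lemma \<beta>_coord:
  assumes "g \<in> base_dom" "a \<in> carrier R"
  shows "\<beta> g (coord g a) = \<beta> g e \<otimes>\<^bsub>R\<^esub> a"
  using assms base_dom_carrier by (simp add: coord_def \<beta>_mult_left[of g e a])

lemma \<beta>_inv_\<beta>_e:
  "g \<in> base_dom \<Longrightarrow> \<beta> (inv g) (\<beta> g e) = e"
  using \<beta>_inv_\<beta>[of g e] e_comm[of "u (inv g)"] by (simp add: base_dom_def)

lemma coord_eq:
  assumes "g \<in> base_dom" "a \<in> carrier R"
  shows "coord g a = \<beta> (inv g) (\<beta> g e \<otimes>\<^bsub>R\<^esub> a)"
  using assms base_dom_carrier by (simp add: coord_def \<beta>_mult \<beta>_inv_\<beta>_e)

text \<open>Primitivity is transported from \<open>e\<close>: the pullback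
  \<open>\<beta> (inv g) c\<close> is a central idempotent below \<open>e\<close>, hence zero or
  \<open>e\<close>, and \<open>\<beta>_coord\<close> recovers \<open>c\<close> from it.\<close>

lemma \<beta>_e_primitive:
  assumes g: "g \<in> base_dom" and c: "central_idempotent R c" "\<beta> g e \<otimes>\<^bsub>R\<^esub> c = c"
    "c \<noteq> \<zero>\<^bsub>R\<^esub>"
  shows "\<beta> g e = c"
proof -
  have gc: "g \<in> carrier G" by (rule base_dom_carrier) fact
  have cc: "c \<in> carrier R" using c(1) by (simp add: central_idempotent_def)
  have *: "coord g c = \<beta> (inv g) c"
    using coord_eq[OF g cc] c(2) by simp
  then have "e \<otimes>\<^bsub>R\<^esub> \<beta> (inv g) c = \<beta> (inv g) c"
    using e_coord[OF gc cc] by simp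
  moreover have "central_idempotent R (\<beta> (inv g) c)"
    using gc c(1) by (intro \<beta>_central_idempotent) auto
  ultimately consider "coord g c = \<zero>\<^bsub>R\<^esub>" | "coord g c = e"
    unfolding * using e_primitive by blast
  then show ?thesis
    using \<beta>_coord[OF g cc] c(2,3) gc by cases simp_all
qed

section \<open>The stabilizer of the base idempotent\<close>

lemma \<beta>_stab:
  assumes "h \<in> base_stab"
  shows "\<beta> h e = e"
proof -
  have h: "h \<in> carrier G" "e \<otimes>\<^bsub>R\<^esub> \<beta> h e = e" "e \<otimes>\<^bsub>R\<^esub> \<beta> (inv h) e = e"
    using assms by (auto simp: base_stab_def)
  have "\<beta> h e = \<beta> h (e \<otimes>\<^bsub>R\<^esub> \<beta> (inv h) e)" using h by simp
  also have "\<dots> = \<beta> h e \<otimes>\<^bsub>R\<^esub> e" using h by (simp add: \<beta>_mult_left[of h e e])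
  also have "\<dots> = e" using h by (simp add: e_comm[of "\<beta> h e"])
  finally show ?thesis .
qed

lemma base_stab_inv: "h \<in> base_stab \<Longrightarrow> inv h \<in> base_stab"
  by (auto simp: base_stab_def)

lemma base_stab_subset: "base_stab \<subseteq> base_dom"
proof
  fix h assume h: "h \<in> base_stab"
  then have "u (inv h) \<otimes>\<^bsub>R\<^esub> e = e"
    using u_mult_\<beta>[of "inv h" e] \<beta>_stab[OF base_stab_inv[OF h]] base_stab_carrier by simp
  then show "h \<in> base_dom"
    using h base_stab_carrier by (simp add: base_dom_def e_comm[of "u (inv h)"])
qed

lemma base_stab_iff:
  "g \<in> base_stab \<longleftrightarrow> g \<in> base_dom \<and> \<beta> g e = e"
proof (intro iffI conjI)
  assume "g \<in> base_dom \<and> \<beta> g e = e"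
  then show "g \<in> base_stab"
    using \<beta>_inv_\<beta>_e[of g] by (simp add: base_stab_def base_dom_carrier)
qed (use base_stab_subset \<beta>_stab in auto)

text \<open>\<open>\<beta> (inv h)\<close> fixes \<open>e\<close>; applied to \<open>e\<close> times
  \<open>u (inv g)\<close>, it produces \<open>u (inv (g \<otimes> h))\<close>. So
  \<open>base_dom\<close> is a union of left cosets of the stabilizer.\<close>

lemma base_dom_mult_stab:
  assumes "g \<in> base_dom" "h \<in> base_stab"
  shows "g \<otimes> h \<in> base_dom"
proof -
  have [simp]: "g \<in> carrier G" "h \<in> carrier G"
    using assms base_dom_carrier base_stab_carrier by auto
  have "e = \<beta> (inv h) (e \<otimes>\<^bsub>R\<^esub> u (inv g))"
    using assms \<beta>_stab[OF base_stab_inv] by (simp add: base_dom_def)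
  also have "\<dots> = e \<otimes>\<^bsub>R\<^esub> u (inv h) \<otimes>\<^bsub>R\<^esub> u (inv (g \<otimes> h))"
    using assms \<beta>_stab[OF base_stab_inv]
    by (simp add: \<beta>_mult \<beta>_u G.inv_mult_group R.m_assoc)
  also have "e \<otimes>\<^bsub>R\<^esub> u (inv h) = e"
    using assms base_stab_subset by (auto simp: base_dom_def)
  finally show ?thesis by (simp add: base_dom_def)
qed

text \<open>By the composition law each of the two idempotents is a \<open>u\<close>-multiple of the
  other, and the \<open>u\<close>-factors commute. The translate of the base factor therefore
  depends only on the left coset.\<close>

lemma \<beta>_mult_stab:
  assumes "g \<in> base_dom" "h \<in> base_stab"
  shows "\<beta> (g \<otimes> h) e = \<beta> g e"
proof -
  have gh: "g \<in> carrier G" "h \<in> carrier G"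
    using assms base_dom_carrier base_stab_carrier by auto
  have "\<beta> g (\<beta> h e) = u g \<otimes>\<^bsub>R\<^esub> \<beta> (g \<otimes> h) e"
    using gh by (simp add: \<beta>_comp)
  then have 1: "\<beta> g e = u g \<otimes>\<^bsub>R\<^esub> \<beta> (g \<otimes> h) e"
    using assms by (simp add: \<beta>_stab)
  have "\<beta> (g \<otimes> h) (\<beta> (inv h) e) = u (g \<otimes> h) \<otimes>\<^bsub>R\<^esub> \<beta> g e"
    using gh by (simp add: \<beta>_comp G.m_assoc)
  then have 2: "\<beta> (g \<otimes> h) e = u (g \<otimes> h) \<otimes>\<^bsub>R\<^esub> \<beta> g e"
    using assms by (simp add: \<beta>_stab base_stab_inv)
  have "\<beta> g e = u g \<otimes>\<^bsub>R\<^esub> u (g \<otimes> h) \<otimes>\<^bsub>R\<^esub> \<beta> g e"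
    using 1 2 gh by (simp add: R.m_assoc)
  also have "\<dots> = u (g \<otimes> h) \<otimes>\<^bsub>R\<^esub> (u g \<otimes>\<^bsub>R\<^esub> \<beta> g e)"
    using gh u_comm[of "g \<otimes> h" "u g"] by (simp add: R.m_assoc)
  finally show ?thesis using 2 gh by simp
qed

text \<open>Equivariance of the coordinates under \<open>H\<close>: since
  \<open>\<beta> (inv h)\<close> fixes \<open>e\<close>, it can be moved past \<open>e\<close>, and
  the remaining factor \<open>u (inv h)\<close> is absorbed.\<close>

lemma coord_stab:
  assumes "g \<in> carrier G" "h \<in> base_stab" "a \<in> carrier R"
  shows "coord (g \<otimes> h) a = \<beta> (inv h) (coord g a)"
proof -
  have [simp]: "h \<in> carrier G"
    using assms base_stab_carrier by auto
  have "\<beta> (inv h) (coord g a) = e \<otimes>\<^bsub>R\<^esub> u (inv h) \<otimes>\<^bsub>R\<^esub> \<beta> (inv h \<otimes> inv g) a"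
    using assms \<beta>_stab[OF base_stab_inv]
    by (simp add: coord_def \<beta>_mult \<beta>_comp R.m_assoc)
  also have "e \<otimes>\<^bsub>R\<^esub> u (inv h) = e"
    using assms base_stab_subset by (auto simp: base_dom_def)
  finally show ?thesis using assms by (simp add: coord_def G.inv_mult_group)
qed

lemma e_\<beta>_mult:
  assumes x: "x \<in> carrier G" and y: "y \<in> carrier G" and "e \<otimes>\<^bsub>R\<^esub> \<beta> x (\<beta> y e) = e"
  shows "e \<otimes>\<^bsub>R\<^esub> \<beta> (x \<otimes> y) e = e"
proof -
  let ?b = "\<beta> (x \<otimes> y) e"
  have b: "?b \<in> carrier R" using x y by simp
  have e: "e = e \<otimes>\<^bsub>R\<^esub> u x \<otimes>\<^bsub>R\<^esub> ?b"
    using assms by (simp add: \<beta>_comp R.m_assoc)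
  then have "e \<otimes>\<^bsub>R\<^esub> u x \<noteq> \<zero>\<^bsub>R\<^esub>"
    using e_nonzero b by auto
  then have "e \<otimes>\<^bsub>R\<^esub> u x = e"
    using x by (simp add: e_mult_u split: if_splits)
  with e show ?thesis by simp
qed

lemma base_stab_subgroup: "subgroup base_stab G"
proof
  show "base_stab \<subseteq> carrier G" using base_stab_carrier by blast
  show "\<one> \<in> base_stab" by (simp add: base_stab_def \<beta>_unit)
  show "inv x \<in> base_stab" if "x \<in> base_stab" for x by (rule base_stab_inv) fact
  have *: "e \<otimes>\<^bsub>R\<^esub> \<beta> (x \<otimes> y) e = e" if "x \<in> base_stab" "y \<in> base_stab" for x y
    using that base_stab_carrier by (intro e_\<beta>_mult) (simp_all add: \<beta>_stab)
  show "x \<otimes> y \<in> base_stab" if "x \<in> base_stab" "y \<in> base_stab" for x y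
    using base_stab_carrier[OF that(1)] base_stab_carrier[OF that(2)] *[OF that]
      *[OF base_stab_inv base_stab_inv, OF that(2,1)]
    by (simp add: base_stab_def G.inv_mult_group)
qed

text \<open>Pulling the common idempotent \<open>\<beta> g e = \<beta> h e\<close> back by
  \<open>inv g\<close> or by \<open>inv h\<close> returns \<open>e\<close>;
  \<open>e_\<beta>_mult\<close> turns these two facts into the two stabilizer conditions.\<close>

lemma base_stabI:
  assumes "g \<in> base_dom" "h \<in> base_dom" "\<beta> g e = \<beta> h e"
  shows "inv g \<otimes> h \<in> base_stab"
proof -
  have [simp]: "g \<in> carrier G" "h \<in> carrier G"
    using assms base_dom_carrier by auto
  have "e \<otimes>\<^bsub>R\<^esub> \<beta> (inv g \<otimes> h) e = e"
    using assms(1) by (intro e_\<beta>_mult) (simp_all add: \<beta>_inv_\<beta>_e flip: assms(3))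
  moreover have "e \<otimes>\<^bsub>R\<^esub> \<beta> (inv h \<otimes> g) e = e"
    using assms(2) by (intro e_\<beta>_mult) (simp_all add: \<beta>_inv_\<beta>_e assms(3))
  ultimately show ?thesis by (simp add: base_stab_def G.inv_mult_group)
qed

end

section \<open>Homogeneous cochains\<close>

lemma length_omit [simp]: "i < length ys \<Longrightarrow> length (omit i ys) = length ys - 1"
  by (simp add: omit_def)

lemma set_omit: "i < length ys \<Longrightarrow> insert (ys ! i) (set (omit i ys)) = set ys"
  by (metis Un_insert_right id_take_nth_drop list.simps(15) omit_def set_append)

lemma length_prism [simp]: "i < length ys \<Longrightarrow> length (prism r i ys) = length ys + 1"
  by (simp add: prism_def)

lemma hd_prism: "ys \<noteq> [] \<Longrightarrow> hd (prism r i ys) = r (hd ys)"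
  by (cases ys) (simp_all add: prism_def)

lemma set_prism:
  assumes "set ys \<subseteq> S" "r ` S \<subseteq> S"
  shows "set (prism r i ys) \<subseteq> S"
  using assms set_take_subset[of "Suc i" ys] set_drop_subset[of i ys]
  by (auto simp: prism_def)

lemma mprod_Nil [simp]: "mprod M [] = \<one>\<^bsub>M\<^esub>"
  and mprod_Cons [simp]: "mprod M (x # xs) = x \<otimes>\<^bsub>M\<^esub> mprod M xs"
  by (simp_all add: mprod_def)

context monoid
begin

lemma mprod_closed [simp]: "set xs \<subseteq> carrier G \<Longrightarrow> mprod G xs \<in> carrier G"
  by (induction xs) auto

lemma mprod_append:
  "\<lbrakk>set xs \<subseteq> carrier G; set ys \<subseteq> carrier G\<rbrakk> \<Longrightarrow> mprod G (xs @ ys) = mprod G xs \<otimes> mprod G ys"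
  by (induction xs) (auto simp: m_assoc)

end

text \<open>The passage from homogeneous to inhomogeneous coordinates: \<open>n + 1\<close> vertices
  give \<open>n\<close> consecutive quotients, unchanged by a common right translation of the
  vertices.\<close>

definition quotients :: "('g, 'm) monoid_scheme \<Rightarrow> 'g list \<Rightarrow> 'g list" where
  "quotients G ys = map2 (\<lambda>x y. x \<otimes>\<^bsub>G\<^esub> inv\<^bsub>G\<^esub> y) ys (tl ys)"

lemma quotients_simps [simp]:
  "quotients G [] = []"
  "quotients G [y] = []"
  "quotients G (y # y' # ys) = (y \<otimes>\<^bsub>G\<^esub> inv\<^bsub>G\<^esub> y') # quotients G (y' # ys)"
  by (simp_all add: quotients_def)

lemma length_quotients [simp]: "length (quotients G ys) = length ys - 1"
  by (simp add: quotients_def)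

lemma nth_quotients:
  "Suc i < length ys \<Longrightarrow> quotients G ys ! i = ys ! i \<otimes>\<^bsub>G\<^esub> inv\<^bsub>G\<^esub> (ys ! Suc i)"
  by (simp add: quotients_def nth_tl)

lemma tl_quotients: "tl (quotients G ys) = quotients G (tl ys)"
  by (cases ys rule: remdups_adj.cases) simp_all

lemma take_quotients: "take i (quotients G ys) = quotients G (take (Suc i) ys)"
  by (rule nth_equalityI) (auto simp: nth_quotients)

lemma drop_quotients: "drop i (quotients G ys) = quotients G (drop i ys)"
  by (rule nth_equalityI) (auto simp: nth_quotients)

lemma quotients_append:
  assumes "xs \<noteq> []" "ys \<noteq> []"
  shows "quotients G (xs @ ys) =
    quotients G xs @ [last xs \<otimes>\<^bsub>G\<^esub> inv\<^bsub>G\<^esub> (hd ys)] @ quotients G ys"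
  using assms(1)
\<comment> \<open>This rule serves as induction over lists of length zero, one and at least two;
  both of its guarded hypotheses amount to the claim for \<open>y # xs\<close>.\<close>
proof (induction xs rule: remdups_adj.induct)
  case (2 x)
  show ?case using assms(2) by (cases ys) simp_all
next
  case (3 x y xs)
  then show ?case by (cases "x = y") simp_all
qed simp

context group
begin

lemma inv_mult_cancel: "\<lbrakk>x \<in> carrier G; y \<in> carrier G\<rbrakk> \<Longrightarrow> inv x \<otimes> (x \<otimes> y) = y"
  by (simp flip: m_assoc)

lemma quotients_closed: "set ys \<subseteq> carrier G \<Longrightarrow> set (quotients G ys) \<subseteq> carrier G"
  by (induction ys rule: remdups_adj.induct) auto

lemma quotients_tuples:
  "\<lbrakk>set ys \<subseteq> carrier G; length ys = Suc n\<rbrakk> \<Longrightarrow> quotients G ys \<in> tuples G n"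
  using quotients_closed by (simp add: tuples_def)

text \<open>After the free choice of the first vertex, the others are forced: the vertex after
  \<open>g\<close> for the quotient \<open>x\<close> is \<open>inv x \<otimes> g\<close>. Thus a
  cochain value can be examined at every coordinate \<open>g\<close>.\<close>

lemma quotients_surj:
  assumes "xs \<in> tuples G n" "g \<in> carrier G"
  obtains ys where "set ys \<subseteq> carrier G" "length ys = Suc n" "hd ys = g" "quotients G ys = xs"
proof -
  have "\<exists>ys. set (g # ys) \<subseteq> carrier G \<and> length ys = length xs \<and> quotients G (g # ys) = xs"
    if "set xs \<subseteq> carrier G" "g \<in> carrier G" for xs g
    using that
  proof (induction xs arbitrary: g)
    case (Cons x xs)
    from Cons.IH[of "inv x \<otimes> g"] Cons.prems obtain ys
      where "set ((inv x \<otimes> g) # ys) \<subseteq> carrier G" "length ys = length xs"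
        "quotients G ((inv x \<otimes> g) # ys) = xs"
      by auto
    with Cons.prems show ?case
      by (intro exI[of _ "(inv x \<otimes> g) # ys"]) (simp add: inv_mult_group flip: m_assoc)
  qed simp
  moreover have "set xs \<subseteq> carrier G" "length xs = n"
    using assms(1) by (auto simp: tuples_def)
  ultimately obtain ys
    where "set (g # ys) \<subseteq> carrier G" "length ys = n" "quotients G (g # ys) = xs"
    using assms(2) by blast
  then show thesis by (intro that[of "g # ys"]) simp_all
qed

text \<open>The product telescopes.\<close>

lemma mprod_quotients:
  assumes "set ys \<subseteq> carrier G" "i < length ys"
  shows "mprod G (take i (quotients G ys)) = hd ys \<otimes> inv (ys ! i)"
  using assms
proof (induction i arbitrary: ys)
  case 0
  then show ?case by (cases ys) auto
next
  case (Suc i)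
  then obtain y y' zs where ys: "ys = y # y' # zs"
    by (metis Suc_le_length_iff Suc_leI le_less_trans less_eq_Suc_le)
  with Suc.prems have [simp]: "y \<in> carrier G" "y' \<in> carrier G" "(y' # zs) ! i \<in> carrier G"
    by (auto simp del: nth_Cons_Suc intro!: subsetD[OF _ nth_mem])
  have "y \<otimes> inv y' \<otimes> (y' \<otimes> inv ((y' # zs) ! i)) = y \<otimes> inv ((y' # zs) ! i)"
    by (simp add: m_assoc inv_mult_cancel del: nth_Cons_Suc)
  then show ?case
    using Suc.IH[of "y' # zs"] Suc.prems ys by simp
qed

text \<open>Multiplying the two quotients that contain \<open>ys ! j\<close> cancels this vertex. So
  the inner coboundary terms are the inner faces; omitting the first or the last vertex belongs to
  the two outer terms.\<close>

lemma merge_at_quotients: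
  assumes "set ys \<subseteq> carrier G" "0 < j" "Suc j < length ys"
  shows "merge_at G j (quotients G ys) = quotients G (omit j ys)"
proof -
  from assms obtain i where j: "j = Suc i" by (cases j) auto
  have [simp]: "ys ! i \<in> carrier G" "ys ! Suc i \<in> carrier G" "ys ! Suc (Suc i) \<in> carrier G"
    using assms j by (auto intro!: subsetD[OF assms(1) nth_mem])
  have "ys ! i \<otimes> inv (ys ! Suc i) \<otimes> (ys ! Suc i \<otimes> inv (ys ! Suc (Suc i))) =
      ys ! i \<otimes> inv (ys ! Suc (Suc i))"
    by (simp add: m_assoc inv_mult_cancel)
  moreover have "quotients G (omit j ys) =
      quotients G (take j ys) @ [last (take j ys) \<otimes> inv (hd (drop (Suc j) ys))] @
      quotients G (drop (Suc j) ys)"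
    unfolding omit_def using assms by (intro quotients_append) auto
  ultimately show ?thesis
    using assms
    by (simp add: merge_at_def j take_quotients drop_quotients nth_quotients hd_drop_conv_nth
        take_Suc_conv_app_nth)
qed

lemma butlast_quotients:
  assumes "length ys = Suc (Suc n)"
  shows "butlast (quotients G ys) = quotients G (omit (Suc n) ys)"
  using assms by (simp add: butlast_conv_take take_quotients omit_def)

lemma mprod_rev_inv:
  "set xs \<subseteq> carrier G \<Longrightarrow> mprod G (rev (map (\<lambda>x. inv x) xs)) = inv (mprod G xs)"
proof (induction xs)
  case (Cons x xs)
  then have "set (rev (map (\<lambda>x. inv x) xs)) \<subseteq> carrier G" by auto
  with Cons show ?case by (simp add: mprod_append inv_mult_group)
qed simp

lemma back_translate_quotients:
  assumes "set ys \<subseteq> carrier G" "i < length ys" "g \<in> carrier G"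
  shows "back_translate G (take i (quotients G ys)) g = ys ! i \<otimes> (inv (hd ys) \<otimes> g)"
proof -
  have [simp]: "ys ! i \<in> carrier G" "hd ys \<in> carrier G"
    using assms by (auto intro!: subsetD[OF assms(1)] hd_in_set)
  have "set (take i (quotients G ys)) \<subseteq> carrier G"
    using quotients_closed[OF assms(1)] set_take_subset by fast
  then show ?thesis
    using assms
    by (simp add: back_translate_def mprod_rev_inv mprod_quotients inv_mult_group m_assoc)
qed

end

section \<open>Cochains as functions on tuples of vertices\<close>

context based_partial_rep
begin

lemma coord_mprod_u:
  assumes "g \<in> base_dom" "set xs \<subseteq> carrier G" "a \<in> carrier R"
  shows "coord g (mprod R (map u xs) \<otimes>\<^bsub>R\<^esub> a) =
    (if \<forall>x\<in>set xs. inv x \<otimes> g \<in> base_dom then coord g a else \<zero>\<^bsub>R\<^esub>)"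
  using assms(2)
proof (induction xs)
  case Nil
  then show ?case using assms by simp
next
  case (Cons x xs)
  have "set (map u xs) \<subseteq> carrier R" using Cons.prems by auto
  with Cons show ?case using assms by (simp add: R.m_assoc coord_u_mult)
qed

lemma tuple_unit_closed [simp]:
  assumes "xs \<in> tuples G n"
  shows "tuple_unit G R u xs \<in> carrier R"
  unfolding tuple_unit_def
proof (rule R.mprod_closed, clarsimp)
  fix i
  have "set (take i xs) \<subseteq> carrier G"
    using assms set_take_subset[of i xs] by (auto simp: tuples_def)
  then show "u (mprod G (take i xs)) \<in> carrier R" by simp
qed

text \<open>The partial products telescope to \<open>hd ys \<otimes> inv (ys ! i)\<close>, and
  \<open>coord_u\<close> tests these by asking whether \<open>ys ! i\<close> lies in
  \<open>base_dom\<close>. The tuple unit thus becomes the indicator of lists over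
  \<open>base_dom\<close>.\<close>

lemma coord_tuple_unit:
  assumes "set ys \<subseteq> carrier G" "hd ys \<in> base_dom" "ys \<noteq> []" "a \<in> carrier R"
  shows "coord (hd ys) (tuple_unit G R u (quotients G ys) \<otimes>\<^bsub>R\<^esub> a) =
    (if set ys \<subseteq> base_dom then coord (hd ys) a else \<zero>\<^bsub>R\<^esub>)"
proof -
  let ?xs = "quotients G ys"
  let ?L = "map (\<lambda>i. mprod G (take i ?xs)) [1..<Suc (length ?xs)]"
  have y: "ys ! i \<in> carrier G" if "i < length ys" for i
    using assms(1) that by auto
  have hd: "hd ys \<in> carrier G" using assms by auto
  have L: "?L = map (\<lambda>i. hd ys \<otimes> inv (ys ! i)) [1..<length ys]"
    using assms by (intro map_cong) (auto simp: G.mprod_quotients)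
  have "inv (hd ys \<otimes> inv (ys ! i)) \<otimes> hd ys = ys ! i" if "i < length ys" for i
    using y[OF that] hd by (simp add: G.inv_mult_group G.m_assoc)
  then have "(\<forall>x\<in>set ?L. inv x \<otimes> hd ys \<in> base_dom) \<longleftrightarrow>
      (\<forall>i\<in>{1..<length ys}. ys ! i \<in> base_dom)"
    unfolding L by auto
  \<comment> \<open>The partial products start at length 1; index 0 is supplied by the assumption on
    the head.\<close>
  also have "\<dots> \<longleftrightarrow> (\<forall>i<length ys. ys ! i \<in> base_dom)"
    using assms(2,3) by (auto simp: hd_conv_nth) (metis One_nat_def Suc_leI atLeastLessThan_iff gr0I)
  also have "\<dots> \<longleftrightarrow> set ys \<subseteq> base_dom"
    by (auto simp: set_conv_nth)
  finally have dom: "(\<forall>x\<in>set ?L. inv x \<otimes> hd ys \<in> base_dom) \<longleftrightarrow> set ys \<subseteq> base_dom" .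
  have "set ?L \<subseteq> carrier G"
    unfolding L using y hd by auto
  moreover have "tuple_unit G R u ?xs = mprod R (map u ?L)"
    by (simp add: tuple_unit_def comp_def)
  ultimately show ?thesis
    using coord_mprod_u[OF assms(2) _ assms(4), of ?L] by (simp only: dom)
qed

text \<open>The function \<open>F\<close> attached to \<open>f\<close>. The default zero makes it
  total with values in the carrier, as the face and prism lemmas require.\<close>

definition homog :: "nat \<Rightarrow> ('g list \<Rightarrow> 'a) \<Rightarrow> 'g list \<Rightarrow> 'a" where
  "homog n f ys =
     (if length ys = Suc n \<and> set ys \<subseteq> base_dom then coord (hd ys) (f (quotients G ys)) else \<zero>\<^bsub>R\<^esub>)"

lemma cochain_closed:
  "\<lbrakk>f \<in> cochains G R u n; xs \<in> tuples G n\<rbrakk> \<Longrightarrow> f xs \<in> carrier R"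
  unfolding cochains_def by (drule PiE_mem) auto

lemma homog_closed [simp]:
  assumes "f \<in> cochains G R u n"
  shows "homog n f ys \<in> carrier R"
proof -
  have "coord (hd ys) (f (quotients G ys)) \<in> carrier R"
    if "length ys = Suc n" "set ys \<subseteq> base_dom"
  proof (intro coord_closed cochain_closed[OF assms] G.quotients_tuples)
    show *: "set ys \<subseteq> carrier G" using that base_dom_carrier by blast
    show "hd ys \<in> carrier G" using that * by (cases ys) auto
  qed fact
  then show ?thesis by (simp add: homog_def)
qed

text \<open>For a cochain the default zero is the true value: \<open>f\<close> takes multiples of
  the tuple unit, whose coordinate vanishes once a vertex leaves \<open>base_dom\<close>.\<close>

lemma coord_cochain:
  assumes "f \<in> cochains G R u n" "set ys \<subseteq> carrier G" "length ys = Suc n"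
  shows "coord (hd ys) (f (quotients G ys)) = homog n f ys"
proof -
  have ys: "ys \<noteq> []" "hd ys \<in> carrier G" "quotients G ys \<in> tuples G n"
    using assms G.quotients_tuples by (cases ys; auto)+
  show ?thesis
  proof (cases "hd ys \<in> base_dom")
    case True
    from assms(1) ys(3) obtain a
      where "a \<in> carrier R" "f (quotients G ys) = tuple_unit G R u (quotients G ys) \<otimes>\<^bsub>R\<^esub> a"
      unfolding cochains_def by (auto dest: PiE_mem)
    with True ys(1) assms show ?thesis
      by (simp add: coord_tuple_unit homog_def)
  next
    case False
    then have "\<not> set ys \<subseteq> base_dom" using ys(1) by (meson hd_in_set subsetD)
    then show ?thesis
      using False ys assms cochain_closed by (simp add: coord_outside homog_def)
  qed
qed

lemma \<beta>_u_inv_mult: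
  "\<lbrakk>g \<in> carrier G; a \<in> carrier R\<rbrakk> \<Longrightarrow> \<beta> g (u (inv g) \<otimes>\<^bsub>R\<^esub> a) = \<beta> g a"
  by (simp add: \<beta>_mult \<beta>_u u_one)

text \<open>The \<open>i\<close>-th coboundary term yields the \<open>i\<close>-th face: the action
  moves the coordinate from the first vertex to the second, merging omits an inner vertex, and the
  last term omits the last one. For \<open>n = 0\<close> the inner sum is empty.\<close>

lemma coord_coboundary:
  assumes f: "f \<in> cochains G R u n"
    and ys: "set ys \<subseteq> carrier G" "length ys = Suc (Suc n)" "hd ys \<in> base_dom"
  shows "coboundary G R \<beta> u n f (quotients G ys) \<in> carrier R" (is "?c \<in> _")
    and "coord (hd ys) (coboundary G R \<beta> u n f (quotients G ys)) =
      (if set ys \<subseteq> base_dom then face_sum R (homog n f) ys else \<zero>\<^bsub>R\<^esub>)"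
proof -
  let ?xs = "quotients G ys"
  \<comment> \<open>All \<open>n + 2\<close> terms without their signs, those with positive index
    already written through faces; only index 0 involves the action.\<close>
  define t where "t i = (if i = 0 then \<beta> (hd ?xs) (u (inv (hd ?xs)) \<otimes>\<^bsub>R\<^esub> f (tl ?xs))
      else u (mprod G (take i ?xs)) \<otimes>\<^bsub>R\<^esub> f (quotients G (omit i ys)))" for i
  have y: "ys ! i \<in> carrier G" if "i \<le> Suc n" for i
    using ys that by auto
  have hd: "hd ys = ys ! 0" using ys(2) by (cases ys) auto
  have xs: "?xs \<in> tuples G (n + 1)"
    using ys by (simp add: G.quotients_tuples)
  have hd_xs: "hd ?xs = ys ! 0 \<otimes> inv (ys ! 1)"
    using ys(2) by (cases ys rule: remdups_adj.cases) auto
  have omit: "set (omit i ys) \<subseteq> carrier G" "length (omit i ys) = Suc n" if "i \<le> Suc n" for i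
    using that ys set_omit[of i ys] by auto
  have f_omit: "f (quotients G (omit i ys)) \<in> carrier R" if "i \<le> Suc n" for i
    using omit[OF that] by (intro cochain_closed[OF f] G.quotients_tuples)
  have f_tl: "f (tl ?xs) = f (quotients G (omit 0 ys))"
    by (simp add: tl_quotients omit_def drop_Suc)
  have t_closed: "t i \<in> carrier R" if "i \<le> Suc n" for i
    using that f_omit[OF that] f_omit[of 0] y[of 0] y[of 1] ys
    by (auto simp: t_def f_tl hd_xs G.mprod_quotients hd y)
  have coord_t: "coord (hd ys) (t i) =
      (if set ys \<subseteq> base_dom then homog n f (omit i ys) else \<zero>\<^bsub>R\<^esub>)" if i: "i \<le> Suc n" for i
  proof -
    \<comment> \<open>The condition on the omitted vertex comes from the action for
      \<open>i = 0\<close> and from the domain idempotent otherwise.\<close>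
    have "coord (hd ys) (t i) =
        (if ys ! i \<in> base_dom then homog n f (omit i ys) else \<zero>\<^bsub>R\<^esub>)"
    proof (cases "i = 0")
      case True
      have "coord (hd ys) (t i) = coord (inv (hd ?xs) \<otimes> hd ys) (f (quotients G (omit 0 ys)))"
        using True f_omit[of 0] y[of 0] y[of 1] ys
        by (simp add: t_def f_tl hd_xs \<beta>_u_inv_mult coord_\<beta>)
      also have "inv (hd ?xs) \<otimes> hd ys = hd (omit 0 ys)"
        using y[of 0] y[of 1] ys(2)
        by (simp add: hd_xs hd G.inv_mult_group G.m_assoc omit_def hd_drop_conv_nth)
      also have "coord (hd (omit 0 ys)) (f (quotients G (omit 0 ys))) = homog n f (omit 0 ys)"
        using omit[of 0] by (intro coord_cochain[OF f]) auto
      finally show ?thesis using True ys(3) hd by simp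
    next
      case False
      then have "hd (omit i ys) = hd ys"
        using ys(2) by (cases ys) (auto simp: omit_def take_Cons')
      moreover have "inv (hd ys \<otimes> inv (ys ! i)) \<otimes> hd ys = ys ! i"
        using y[of 0] y[OF i] by (simp add: hd G.inv_mult_group G.m_assoc)
      ultimately show ?thesis
        using False f_omit[OF i] y[of 0] y[OF i] ys i coord_cochain[OF f omit[OF i]]
        by (simp add: t_def G.mprod_quotients coord_u_mult flip: hd)
    qed
    \<comment> \<open>The face lacks only \<open>ys ! i\<close>, so a vertex outside
      \<open>base_dom\<close> must survive in it.\<close>
    moreover have "homog n f (omit i ys) = \<zero>\<^bsub>R\<^esub>"
      if "ys ! i \<in> base_dom" "\<not> set ys \<subseteq> base_dom"
    proof -
      have "\<not> set (omit i ys) \<subseteq> base_dom"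
        using that set_omit[of i ys] ys(2) i by (metis insert_subset le_imp_less_Suc)
      then show ?thesis by (simp add: homog_def)
    qed
    moreover have "ys ! i \<in> base_dom" if "set ys \<subseteq> base_dom"
      using that ys(2) i by auto
    ultimately show ?thesis by auto
  qed
  let ?s = "\<lambda>i. [((- 1 :: int) ^ i)] \<cdot>\<^bsub>R\<^esub> t i"
  have "?c = t 0 \<oplus>\<^bsub>R\<^esub> (\<Oplus>\<^bsub>R\<^esub>i\<in>{1..n}. ?s i) \<oplus>\<^bsub>R\<^esub> ?s (n + 1)"
  proof -
    have "(\<Oplus>\<^bsub>R\<^esub>i\<in>{1..n}. [((- 1 :: int) ^ i)] \<cdot>\<^bsub>R\<^esub>
        (u (mprod G (take i ?xs)) \<otimes>\<^bsub>R\<^esub> f (merge_at G i ?xs))) = (\<Oplus>\<^bsub>R\<^esub>i\<in>{1..n}. ?s i)"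
    proof (rule R.finsum_cong')
      show "?s \<in> {1..n} \<rightarrow> carrier R" using t_closed by auto
    qed (use ys in \<open>auto simp: t_def G.merge_at_quotients\<close>)
    moreover have "t (n + 1) = u (mprod G ?xs) \<otimes>\<^bsub>R\<^esub> f (butlast ?xs)"
      using ys G.butlast_quotients[of ys n] by (simp add: t_def)
    ultimately show ?thesis using xs by (simp add: coboundary_def t_def)
  qed
  also have "\<dots> = (\<Oplus>\<^bsub>R\<^esub>i\<in>{..Suc n}. ?s i)"
  proof -
    have "{..Suc n} = insert 0 (insert (Suc n) {1..n})" by auto
    moreover have "?s \<in> {1..n} \<rightarrow> carrier R" using t_closed by auto
    ultimately show ?thesis
      using t_closed[of 0] t_closed[of "Suc n"]
      by (simp add: R.finsum_insert R.finsum_closed R.sign_add_pow[of "t 0" 0, simplified]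
          R.a_ac del: power_Suc)
  qed
  finally have c: "?c = (\<Oplus>\<^bsub>R\<^esub>i\<in>{..Suc n}. ?s i)" .
  show "?c \<in> carrier R"
    unfolding c using t_closed by (intro R.finsum_closed) auto
  have "coord (hd ys) ?c = (\<Oplus>\<^bsub>R\<^esub>i\<in>{..Suc n}. coord (hd ys) (?s i))"
    unfolding c using t_closed ys(3) base_dom_carrier by (intro coord_finsum) auto
  also have "\<dots> = (\<Oplus>\<^bsub>R\<^esub>i\<in>{..Suc n}. if set ys \<subseteq> base_dom
      then [((- 1 :: int) ^ i)] \<cdot>\<^bsub>R\<^esub> homog n f (omit i ys) else \<zero>\<^bsub>R\<^esub>)"
    using t_closed ys(3) base_dom_carrier f
    by (intro R.finsum_cong') (auto simp: coord_a_inv coord_t R.sign_add_pow R.neg_zero)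
  also have "\<dots> = (if set ys \<subseteq> base_dom then face_sum R (homog n f) ys else \<zero>\<^bsub>R\<^esub>)"
    using f ys(2) by (simp add: R.face_sum_eq_finsum[of "homog n f" ys "Suc n"] R.finsum_zero)
  finally show "coord (hd ys) ?c =
      (if set ys \<subseteq> base_dom then face_sum R (homog n f) ys else \<zero>\<^bsub>R\<^esub>)" .
qed

end

section \<open>The retraction onto the stabilizer\<close>

locale transversal_partial_rep = based_partial_rep G R \<beta> u e
  for G :: "('g, 'm) monoid_scheme" (structure) and R :: "('a, 'r) ring_scheme" (structure)
    and \<beta> u e +
  fixes T :: "'g set"
  assumes transversal: "left_transversal G base_stab T"
begin

abbreviation rep :: "'g \<Rightarrow> 'g" where
  "rep \<equiv> coset_rep G base_stab T"

text \<open>The \<open>H\<close>-part of \<open>y\<close>, inverse to the value of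
  \<open>eta\<close>. In this form right translation by \<open>H\<close> is respected:
  \<open>rep\<close> is constant on left cosets.\<close>

definition retract :: "'g \<Rightarrow> 'g" where
  "retract y = inv (rep y) \<otimes> y"

lemma rep:
  assumes "y \<in> carrier G"
  shows "rep y \<in> T" "y \<in> rep y <# base_stab" "rep y \<in> carrier G"
proof -
  have "\<exists>!t. t \<in> T \<and> y \<in> t <# base_stab" "T \<subseteq> carrier G"
    using transversal assms by (auto simp: left_transversal_def)
  then show "rep y \<in> T" "y \<in> rep y <# base_stab" "rep y \<in> carrier G"
    unfolding coset_rep_def by (auto dest!: theI')
qed

lemma rep_eqI:
  assumes "t \<in> T" "h \<in> base_stab"
  shows "rep (t \<otimes> h) = t"
proof -
  have t: "T \<subseteq> carrier G" using transversal by (simp add: left_transversal_def)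
  then have "t \<otimes> h \<in> carrier G" using assms base_stab_carrier by auto
  then have "\<exists>!s. s \<in> T \<and> t \<otimes> h \<in> s <# base_stab"
    using transversal by (simp add: left_transversal_def)
  moreover have "t \<otimes> h \<in> t <# base_stab" using assms(2) by (auto simp: l_coset_def)
  ultimately show ?thesis using assms(1) unfolding coset_rep_def by (intro the1_equality) auto
qed

lemma retract_base_stab:
  assumes "y \<in> carrier G"
  shows "retract y \<in> base_stab"
proof -
  from rep(2)[OF assms] obtain h where h: "h \<in> base_stab" "y = rep y \<otimes> h"
    by (auto simp: l_coset_def)
  then have "retract y = inv (rep y) \<otimes> (rep y \<otimes> h)" by (simp add: retract_def)
  then show ?thesis
    using h(1) rep(3)[OF assms] base_stab_carrier by (simp add: G.inv_mult_cancel)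
qed

lemma retract_closed [simp]: "y \<in> carrier G \<Longrightarrow> retract y \<in> carrier G"
  using retract_base_stab base_stab_carrier by blast

lemma rep_retract: "y \<in> carrier G \<Longrightarrow> rep y \<otimes> retract y = y"
  using rep(3)[of y] by (simp add: retract_def flip: G.m_assoc)

lemma rep_mult_stab:
  assumes "y \<in> carrier G" "h \<in> base_stab"
  shows "rep (y \<otimes> h) = rep y"
proof -
  have "y \<otimes> h = rep y \<otimes> (retract y \<otimes> h)"
    using assms base_stab_carrier rep(3)[of y] by (simp add: rep_retract flip: G.m_assoc)
  then show ?thesis
    using assms rep(1)[of y] retract_base_stab[of y] subgroup.m_closed[OF base_stab_subgroup]
    by (simp add: rep_eqI)
qed

lemma retract_base_dom: "y \<in> carrier G \<Longrightarrow> retract y \<in> base_dom"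
  using retract_base_stab base_stab_subset by blast

text \<open>\<open>rep y\<close> differs from \<open>y\<close> by a right factor in the stabilizer,
  and \<open>base_dom\<close> is a union of left cosets.\<close>

lemma rep_base_dom:
  assumes "y \<in> base_dom"
  shows "rep y \<in> base_dom"
proof -
  have y: "y \<in> carrier G" by (rule base_dom_carrier) fact
  have "y \<otimes> inv (retract y) \<in> base_dom"
    using assms y by (intro base_dom_mult_stab base_stab_inv retract_base_stab)
  also have "y \<otimes> inv (retract y) = rep y"
    using y rep(3)[of y] by (simp add: retract_def G.inv_mult_group flip: G.m_assoc)
  finally show ?thesis .
qed

text \<open>By \<open>base_stabI\<close> both elements lie in the same left coset, which has one
  representative. This makes the identification of indices with transversal elements
  unambiguous.\<close>

lemma \<beta>_e_inj:
  assumes "g \<in> T \<inter> base_dom" "h \<in> T \<inter> base_dom" "\<beta> g e = \<beta> h e"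
  shows "g = h"
proof -
  have gh: "g \<in> carrier G" "h \<in> carrier G"
    using assms base_dom_carrier by auto
  have "rep (g \<otimes> (inv g \<otimes> h)) = g"
    using assms by (intro rep_eqI base_stabI) auto
  moreover have "rep (h \<otimes> \<one>) = h"
    using assms subgroup.one_closed[OF base_stab_subgroup] by (intro rep_eqI) auto
  ultimately show ?thesis using gh by (simp flip: G.m_assoc)
qed

lemma eta_eq: "y \<in> carrier G \<Longrightarrow> eta G base_stab T y = inv (retract y)"
  using rep(3)[of y] by (simp add: eta_def retract_def G.inv_mult_group)

text \<open>The argument of \<open>eta\<close> is \<open>y\<close> times the inverse of
  \<open>retract x\<close>, an element of \<open>H\<close>, so the equivariance of the retraction
  evaluates it.\<close>

lemma eta_quotient:
  assumes "x \<in> carrier G" "y \<in> carrier G"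
  shows "eta G base_stab T (inv (x \<otimes> inv y) \<otimes> rep x) = retract x \<otimes> inv (retract y)"
proof -
  have "inv (x \<otimes> inv y) \<otimes> rep x = y \<otimes> inv (retract x)"
    using assms rep(3)[of x] by (simp add: retract_def G.inv_mult_group G.m_assoc)
  moreover have "retract (y \<otimes> inv (retract x)) = retract y \<otimes> inv (retract x)"
    using assms rep(3)[of y] retract_base_stab[OF assms(1)]
    by (simp add: retract_def[of "y \<otimes> _"] retract_def[of y] rep_mult_stab base_stab_inv G.m_assoc)
  ultimately show ?thesis
    using assms by (simp add: eta_eq G.inv_mult_group)
qed

text \<open>Back translation gives \<open>ys ! i\<close> times the inverse of
  \<open>retract (hd ys)\<close>, and a right factor in \<open>H\<close> does not affect
  \<open>rep\<close>.\<close>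

lemma rep_back_translate:
  assumes "set ys \<subseteq> carrier G" "i < length ys"
  shows "rep (back_translate G (take i (quotients G ys)) (rep (hd ys))) = rep (ys ! i)"
proof -
  have y: "hd ys \<in> carrier G" "ys ! i \<in> carrier G"
    using assms by (auto intro!: subsetD[OF assms(1)] hd_in_set)
  have "inv (hd ys) \<otimes> rep (hd ys) = inv (retract (hd ys))"
    using y rep(3)[of "hd ys"] by (simp add: retract_def G.inv_mult_group)
  then show ?thesis
    using assms y rep(3)[of "hd ys"]
    by (simp add: G.back_translate_quotients rep_mult_stab base_stab_inv retract_base_stab)
qed

text \<open>In homogeneous coordinates \<open>tau\<close> retracts every vertex: its entries have
  the form computed in \<open>eta_quotient\<close>, with \<open>rep_back_translate\<close> supplying
  the representatives.\<close>

lemma tau_quotients: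
  assumes "set ys \<subseteq> carrier G"
  shows "tau G base_stab T (rep (hd ys)) (quotients G ys) = quotients G (map retract ys)"
proof (rule nth_equalityI)
  show "length (tau G base_stab T (rep (hd ys)) (quotients G ys)) =
      length (quotients G (map retract ys))"
    by (simp add: tau_def del: upt_Suc)
next
  fix i assume "i < length (tau G base_stab T (rep (hd ys)) (quotients G ys))"
  then have i: "Suc i < length ys" by (simp add: tau_def del: upt_Suc)
  then have y: "ys ! i \<in> carrier G" "ys ! Suc i \<in> carrier G"
    using assms by auto
  have "take (Suc i) (quotients G ys) =
      take i (quotients G ys) @ [ys ! i \<otimes> inv (ys ! Suc i)]"
    using i by (simp add: take_Suc_conv_app_nth nth_quotients)
  \<comment> \<open>The index list of \<open>tau\<close> starts at 1, so its entry number
    \<open>i\<close> uses the prefix of length \<open>Suc i\<close>.\<close>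
  moreover have "[Suc 0..<Suc (length ys - Suc 0)] ! i = Suc i"
    using nth_upt[of "Suc 0" i "Suc (length ys - Suc 0)"] i by (simp del: upt_Suc)
  ultimately show "tau G base_stab T (rep (hd ys)) (quotients G ys) ! i =
      quotients G (map retract ys) ! i"
    using i y assms
    by (simp add: tau_def eta_tuple_def rep_back_translate eta_quotient nth_quotients
        del: upt_Suc)
qed

text \<open>The vertex \<open>ys ! i\<close> occurs retracted and unretracted; the quotient of the
  two is \<open>inv (rep (ys ! i))\<close>, the middle entry of \<open>sigma\<close>.\<close>

lemma sigma_quotients:
  assumes "set ys \<subseteq> carrier G" "i < length ys"
  shows "sigma G base_stab T i (rep (hd ys)) (quotients G ys) = quotients G (prism retract i ys)"
proof -
  have y: "ys ! i \<in> carrier G"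
    using assms by auto
  have "quotients G (prism retract i ys) =
      quotients G (map retract (take (Suc i) ys)) @
      [last (map retract (take (Suc i) ys)) \<otimes> inv (hd (drop i ys))] @ quotients G (drop i ys)"
    unfolding prism_def using assms(2) by (intro quotients_append) auto
  also have "last (map retract (take (Suc i) ys)) \<otimes> inv (hd (drop i ys)) = inv (rep (ys ! i))"
    using assms(2) y rep(3)[OF y]
    by (simp add: take_Suc_conv_app_nth hd_drop_conv_nth retract_def G.m_assoc)
  also have "quotients G (map retract (take (Suc i) ys)) =
      tau G base_stab T (rep (hd ys)) (take i (quotients G ys))"
  proof -
    have "set (take (Suc i) ys) \<subseteq> carrier G"
      using assms(1) set_take_subset by fast
    from tau_quotients[OF this] show ?thesis
      by (simp add: take_quotients)
  qed
  finally have "quotients G (prism retract i ys) =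
      tau G base_stab T (rep (hd ys)) (take i (quotients G ys)) @
      [inv (rep (ys ! i))] @ drop i (quotients G ys)"
    by (simp add: drop_quotients)
  \<comment> \<open>The separate clause of \<open>sigma\<close> for index 0 agrees with the general
    form, since \<open>tau\<close> of the empty list is empty.\<close>
  then show ?thesis
    using assms rep_back_translate[OF assms] hd_conv_nth[of ys]
    by (auto simp: sigma_def tau_def)
qed

end

section \<open>The homotopy formula\<close>

text \<open>\<open>glue b\<close> plays the role of the product of the \<open>\<theta>\<^sub>g(b g)\<close>.\<close>

locale glued_partial_rep = transversal_partial_rep G R \<beta> u e T
  for G :: "('g, 'm) monoid_scheme" (structure) and R :: "('a, 'r) ring_scheme" (structure)
    and \<beta> u e T +
  fixes glue :: "('g \<Rightarrow> 'a) \<Rightarrow> 'a"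
  assumes coord_separates:
      "\<lbrakk>a \<in> carrier R; b \<in> carrier R; \<And>g. g \<in> base_dom \<Longrightarrow> coord g a = coord g b\<rbrakk> \<Longrightarrow> a = b"
    and glue_closed:
      "(\<And>g. g \<in> T \<inter> base_dom \<Longrightarrow> f g \<in> carrier R) \<Longrightarrow> glue f \<in> carrier R"
    and coord_glue:
      "\<lbrakk>\<And>g. g \<in> T \<inter> base_dom \<Longrightarrow> f g \<in> carrier R; g \<in> T \<inter> base_dom\<rbrakk> \<Longrightarrow>
        coord g (glue f) = coord \<one> (f g)"
begin

text \<open>Writing \<open>y\<close> as \<open>rep y \<otimes> retract y\<close>, equivariance
  reduces to the transversal, where the glued element is known, and then takes the coordinate at the
  identity to the one at \<open>retract y\<close>.\<close>

lemma coord_glue_retract: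
  assumes "\<And>g. g \<in> T \<inter> base_dom \<Longrightarrow> b g \<in> carrier R" "y \<in> base_dom"
  shows "coord y (glue b) = coord (retract y) (b (rep y))"
proof -
  have y: "y \<in> carrier G" by (rule base_dom_carrier) fact
  have r: "rep y \<in> T \<inter> base_dom" using rep(1)[OF y] rep_base_dom[OF assms(2)] by blast
  have "coord y (glue b) = \<beta> (inv (retract y)) (coord (rep y) (glue b))"
    using coord_stab[of "rep y" "retract y" "glue b"] y glue_closed[OF assms(1)]
    by (simp add: rep_retract rep(3) retract_base_stab)
  also have "coord (rep y) (glue b) = coord \<one> (b (rep y))"
    using assms(1) r by (rule coord_glue)
  also have "\<beta> (inv (retract y)) \<dots> = coord (retract y) (b (rep y))"
    using coord_stab[of \<one> "retract y" "b (rep y)"] y assms(1)[OF r]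
    by (simp add: retract_base_stab)
  finally show ?thesis .
qed

lemma retract_image: "retract ` base_dom \<subseteq> base_dom"
  using retract_base_dom base_dom_carrier by blast

text \<open>Coordinates separate elements, and \<open>quotients_surj\<close> realizes any tuple by a
  vertex list starting at a prescribed \<open>g\<close>.\<close>

lemma cochain_eqI:
  assumes "\<And>xs. xs \<in> tuples G n \<Longrightarrow> f xs \<in> carrier R" "\<And>xs. xs \<in> tuples G n \<Longrightarrow> f' xs \<in> carrier R"
    and "\<And>ys. \<lbrakk>set ys \<subseteq> carrier G; length ys = Suc n; hd ys \<in> base_dom\<rbrakk> \<Longrightarrow>
      coord (hd ys) (f (quotients G ys)) = coord (hd ys) (f' (quotients G ys))"
    and xs: "xs \<in> tuples G n"
  shows "f xs = f' xs"
proof (rule coord_separates)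
  fix g assume "g \<in> base_dom"
  then obtain ys where "set ys \<subseteq> carrier G" "length ys = Suc n" "hd ys = g" "quotients G ys = xs"
    using G.quotients_surj[OF xs] base_dom_carrier by metis
  with \<open>g \<in> base_dom\<close> assms(3)[of ys] show "coord g (f xs) = coord g (f' xs)" by simp
qed (use assms in auto)

text \<open>Degrees are shifted: \<open>w\<close> and \<open>w'\<close> have degree
  \<open>Suc n\<close> and \<open>\<epsilon>\<close> has degree \<open>n\<close>, which avoids
  subtraction.\<close>

context
  fixes n :: nat and w w' \<epsilon> :: "'g list \<Rightarrow> 'a"
  assumes w: "w \<in> cocycles G R \<beta> u (Suc n)"
  defines "w' \<equiv> \<lambda>xs\<in>tuples G (Suc n). tuple_unit G R u xs \<otimes>\<^bsub>R\<^esub>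
      glue (\<lambda>g. w (tau G base_stab T g xs))"
    and "\<epsilon> \<equiv> \<lambda>xs\<in>tuples G n. tuple_unit G R u xs \<otimes>\<^bsub>R\<^esub>
      glue (\<lambda>g. \<Oplus>\<^bsub>R\<^esub>i\<in>{0..n}. [((- 1 :: int) ^ i)] \<cdot>\<^bsub>R\<^esub> w (sigma G base_stab T i g xs))"
begin

lemma w_cochain: "w \<in> cochains G R u (Suc n)"
  using w by (simp add: cocycles_def)

text \<open>Read off from the vertex descriptions, with a list starting at \<open>g\<close>; an
  element \<open>g\<close> of the transversal is its own representative.\<close>

lemma tau_sigma_tuples:
  assumes "g \<in> T \<inter> base_dom" "xs \<in> tuples G m"
  shows "tau G base_stab T g xs \<in> tuples G m"
    and "i \<le> m \<Longrightarrow> sigma G base_stab T i g xs \<in> tuples G (Suc m)"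
proof -
  obtain ys where ys: "set ys \<subseteq> carrier G" "length ys = Suc m" "hd ys = g" "quotients G ys = xs"
    using G.quotients_surj[OF assms(2)] assms(1) base_dom_carrier by (metis IntD2)
  have g: "rep g = g"
    using rep_eqI[of g \<one>] assms(1) base_dom_carrier subgroup.one_closed[OF base_stab_subgroup]
    by auto
  have r: "retract ` carrier G \<subseteq> carrier G" by auto
  show "tau G base_stab T g xs \<in> tuples G m"
    using ys tau_quotients[OF ys(1)] by (auto simp: g intro!: G.quotients_tuples retract_closed)
  show "sigma G base_stab T i g xs \<in> tuples G (Suc m)" if "i \<le> m"
    using ys sigma_quotients[OF ys(1), of i] that set_prism[OF ys(1) r]
    by (auto simp: g intro!: G.quotients_tuples)
qed

lemma w_tau_closed:
  "\<lbrakk>g \<in> T \<inter> base_dom; xs \<in> tuples G (Suc n)\<rbrakk> \<Longrightarrow> w (tau G base_stab T g xs) \<in> carrier R"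
  by (intro cochain_closed[OF w_cochain] tau_sigma_tuples)

lemma w_sigma_closed:
  assumes "g \<in> T \<inter> base_dom" "xs \<in> tuples G n"
  shows "(\<Oplus>\<^bsub>R\<^esub>i\<in>{0..n}. [((- 1 :: int) ^ i)] \<cdot>\<^bsub>R\<^esub> w (sigma G base_stab T i g xs)) \<in> carrier R"
  using assms
  by (intro R.finsum_closed Pi_I R.sign_add_pow_closed cochain_closed[OF w_cochain]
      tau_sigma_tuples) auto

lemma w'_cochain: "w' \<in> cochains G R u (Suc n)"
  unfolding w'_def cochains_def using w_tau_closed by (auto intro!: glue_closed)

lemma \<epsilon>_cochain: "\<epsilon> \<in> cochains G R u n"
  unfolding \<epsilon>_def cochains_def using w_sigma_closed by (auto intro!: glue_closed)

text \<open>Over \<open>base_dom\<close> the tuple unit disappears, and gluing moves the coordinate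
  to \<open>retract (hd ys)\<close>, which is the head of the retracted list produced by
  \<open>tau_quotients\<close>.\<close>

lemma homog_w':
  assumes "set ys \<subseteq> base_dom" "length ys = Suc (Suc n)"
  shows "homog (Suc n) w' ys = homog (Suc n) w (map retract ys)"
proof -
  have ys: "set ys \<subseteq> carrier G" using assms(1) base_dom_carrier by blast
  have hd: "hd ys \<in> base_dom" "ys \<noteq> []" using assms by (cases ys; auto)+
  have xs: "quotients G ys \<in> tuples G (Suc n)"
    using ys assms(2) by (intro G.quotients_tuples) auto
  have "homog (Suc n) w' ys =
      coord (hd ys) (glue (\<lambda>g. w (tau G base_stab T g (quotients G ys))))"
    using assms hd ys xs glue_closed[OF w_tau_closed[OF _ xs]]
    by (simp add: homog_def w'_def coord_tuple_unit)
  also have "\<dots> = coord (retract (hd ys)) (w (tau G base_stab T (rep (hd ys)) (quotients G ys)))"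
    using w_tau_closed[OF _ xs] hd(1) by (rule coord_glue_retract)
  also have "\<dots> = coord (hd (map retract ys)) (w (quotients G (map retract ys)))"
    using ys hd(2) by (simp add: tau_quotients hd_map)
  also have "\<dots> = homog (Suc n) w (map retract ys)"
    using assms ys by (intro coord_cochain[OF w_cochain]) auto
  finally show ?thesis .
qed

text \<open>As for \<open>w'\<close>, but the summands evaluate \<open>w\<close> on prisms by
  \<open>sigma_quotients\<close>; all these prisms share the head \<open>retract (hd ys)\<close>, so
  one coordinate serves the whole sum.\<close>

lemma homog_\<epsilon>:
  assumes "set ys \<subseteq> base_dom" "length ys = Suc n"
  shows "homog n \<epsilon> ys = prism_sum R retract (homog (Suc n) w) ys"
proof -
  let ?s = "\<lambda>g i. w (sigma G base_stab T i g (quotients G ys))"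
  have ys: "set ys \<subseteq> carrier G" using assms(1) base_dom_carrier by blast
  have hd: "hd ys \<in> base_dom" "hd ys \<in> carrier G" "ys \<noteq> []"
    using assms ys by (cases ys; auto)+
  have xs: "quotients G ys \<in> tuples G n"
    using ys assms(2) by (intro G.quotients_tuples) auto
  have rep: "rep (hd ys) \<in> T \<inter> base_dom"
    using hd by (simp add: rep(1) rep_base_dom)
  have s_closed: "?s (rep (hd ys)) i \<in> carrier R" if "i \<le> n" for i
    using that rep xs by (intro cochain_closed[OF w_cochain] tau_sigma_tuples)
  have "homog n \<epsilon> ys =
      coord (hd ys) (glue (\<lambda>g. \<Oplus>\<^bsub>R\<^esub>i\<in>{0..n}. [((- 1 :: int) ^ i)] \<cdot>\<^bsub>R\<^esub> ?s g i))"
    using assms hd ys xs glue_closed[OF w_sigma_closed[OF _ xs]]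
    by (simp add: homog_def \<epsilon>_def coord_tuple_unit)
  also have "\<dots> = coord (retract (hd ys))
      (\<Oplus>\<^bsub>R\<^esub>i\<in>{0..n}. [((- 1 :: int) ^ i)] \<cdot>\<^bsub>R\<^esub> ?s (rep (hd ys)) i)"
    using w_sigma_closed[OF _ xs] hd(1) by (rule coord_glue_retract)
  also have "\<dots> = (\<Oplus>\<^bsub>R\<^esub>i\<in>{0..n}.
      coord (retract (hd ys)) ([((- 1 :: int) ^ i)] \<cdot>\<^bsub>R\<^esub> ?s (rep (hd ys)) i))"
    using hd s_closed by (intro coord_finsum) auto
  also have "\<dots> = (\<Oplus>\<^bsub>R\<^esub>i\<in>{..n}. [((- 1 :: int) ^ i)] \<cdot>\<^bsub>R\<^esub> homog (Suc n) w (prism retract i ys))"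
  proof (rule R.finsum_cong')
    fix i assume "i \<in> {..n}"
    then have i: "i \<le> n" by simp
    then have "coord (retract (hd ys)) ([((- 1 :: int) ^ i)] \<cdot>\<^bsub>R\<^esub> ?s (rep (hd ys)) i) =
        [((- 1 :: int) ^ i)] \<cdot>\<^bsub>R\<^esub>
          coord (hd (prism retract i ys)) (w (quotients G (prism retract i ys)))"
      using hd s_closed[OF i] sigma_quotients[OF ys, of i] hd_prism[of ys retract i] assms(2)
      by (simp add: coord_sign)
    also have "coord (hd (prism retract i ys)) (w (quotients G (prism retract i ys))) =
        homog (Suc n) w (prism retract i ys)"
      using assms(2) i by (intro coord_cochain[OF w_cochain] set_prism[OF ys]) auto
    finally show "coord (retract (hd ys)) ([((- 1 :: int) ^ i)] \<cdot>\<^bsub>R\<^esub> ?s (rep (hd ys)) i) =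
        [((- 1 :: int) ^ i)] \<cdot>\<^bsub>R\<^esub> homog (Suc n) w (prism retract i ys)" .
  qed (use w_cochain in auto)
  also have "\<dots> = prism_sum R retract (homog (Suc n) w) ys"
    using w_cochain assms(2) by (intro R.prism_sum_eq_finsum[symmetric]) auto
  finally show ?thesis .
qed

lemma face_sum_homog_w:
  assumes "set ys \<subseteq> base_dom" "length ys = Suc (Suc (Suc n))"
  shows "face_sum R (homog (Suc n) w) ys = \<zero>\<^bsub>R\<^esub>"
proof -
  have ys: "set ys \<subseteq> carrier G" using assms(1) base_dom_carrier by blast
  have hd: "hd ys \<in> base_dom" using assms by (cases ys) auto
  have "quotients G ys \<in> tuples G (Suc n + 1)"
    using ys assms(2) by (simp add: G.quotients_tuples)
  then have "coboundary G R \<beta> u (Suc n) w (quotients G ys) = \<zero>\<^bsub>R\<^esub>"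
    using w by (simp add: cocycles_def)
  then show ?thesis
    using coord_coboundary(2)[OF w_cochain ys assms(2) hd] assms(1) hd base_dom_carrier by simp
qed

text \<open>In coordinates this is \<open>face_prism_homotopy\<close> for
  \<open>homog (Suc n) w\<close>, whose own face sum vanishes. On lists not contained in
  \<open>base_dom\<close> all terms are zero.\<close>

lemma w_eq:
  "w = (\<lambda>xs\<in>tuples G (Suc n). coboundary G R \<beta> u n \<epsilon> xs \<oplus>\<^bsub>R\<^esub> w' xs)"
proof (rule extensionalityI)
  show "w \<in> extensional (tuples G (Suc n))"
    using w_cochain by (auto simp: cochains_def PiE_def)
  fix xs assume xs: "xs \<in> tuples G (Suc n)"
  \<comment> \<open>Membership comes from the first part of \<open>coord_coboundary\<close>; the
    identity is a vertex of \<open>base_dom\<close> at which the list may start.\<close>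
  have c: "coboundary G R \<beta> u n \<epsilon> zs \<in> carrier R" if zs: "zs \<in> tuples G (Suc n)" for zs
  proof -
    obtain ys where "set ys \<subseteq> carrier G" "length ys = Suc (Suc n)" "hd ys = \<one>" "quotients G ys = zs"
      using G.quotients_surj[OF zs G.one_closed] by metis
    then show ?thesis
      using coord_coboundary(1)[OF \<epsilon>_cochain, of ys] one_in_base_dom by simp
  qed
  have "w xs = coboundary G R \<beta> u n \<epsilon> xs \<oplus>\<^bsub>R\<^esub> w' xs"
  proof (rule cochain_eqI[OF _ _ _ xs])
    fix ys assume ys: "set ys \<subseteq> carrier G" "length ys = Suc (Suc n)" and hd: "hd ys \<in> base_dom"
    let ?F = "homog (Suc n) w"
    have "?F ys = (if set ys \<subseteq> base_dom then face_sum R (homog n \<epsilon>) ys else \<zero>\<^bsub>R\<^esub>) \<oplus>\<^bsub>R\<^esub>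
        homog (Suc n) w' ys"
    proof (cases "set ys \<subseteq> base_dom")
      case True
      have "face_sum R (homog n \<epsilon>) ys = face_sum R (prism_sum R retract ?F) ys"
        using ys(2) homog_\<epsilon> True by (intro R.face_sum_cong[of base_dom]) auto
      moreover have "prism_sum R retract (face_sum R ?F) ys = \<zero>\<^bsub>R\<^esub>"
        using ys(2) True retract_image
        by (intro R.prism_sum_eq_zero[of base_dom] face_sum_homog_w) auto
      ultimately have "face_sum R (homog n \<epsilon>) ys = ?F ys \<ominus>\<^bsub>R\<^esub> ?F (map retract ys)"
        using R.face_prism_homotopy[of ?F retract ys] w_cochain by simp
      then show ?thesis
        using True w_cochain homog_w'[OF True ys(2)]
        by (simp add: a_minus_def R.a_assoc R.l_neg)
    qed (simp add: homog_def)
    then show "coord (hd ys) (w (quotients G ys)) =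
        coord (hd ys) (coboundary G R \<beta> u n \<epsilon> (quotients G ys) \<oplus>\<^bsub>R\<^esub> w' (quotients G ys))"
      using ys hd coord_coboundary[OF \<epsilon>_cochain ys hd] coord_cochain[OF w_cochain ys]
        coord_cochain[OF w'_cochain ys] base_dom_carrier
        cochain_closed[OF w'_cochain G.quotients_tuples[OF ys]]
      by (simp add: coord_add)
  qed (use c cochain_closed[OF w_cochain] cochain_closed[OF w'_cochain] in auto)
  then show "w xs = (\<lambda>xs\<in>tuples G (Suc n). coboundary G R \<beta> u n \<epsilon> xs \<oplus>\<^bsub>R\<^esub> w' xs) xs"
    using xs by simp
qed simp

text \<open>Checked directly in coordinates: the face sum commutes with the retraction, and the face
  sum of \<open>w\<close> vanishes on retracted lists.\<close>

lemma w'_cocycle: "w' \<in> cocycles G R \<beta> u (Suc n)"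
proof -
  have "coboundary G R \<beta> u (Suc n) w' xs = \<zero>\<^bsub>R\<^esub>" if xs: "xs \<in> tuples G (Suc (Suc n))" for xs
  proof (rule coord_separates)
    fix g assume g: "g \<in> base_dom"
    then obtain ys where ys: "set ys \<subseteq> carrier G" "length ys = Suc (Suc (Suc n))" "hd ys = g"
      "quotients G ys = xs"
      using G.quotients_surj[OF xs] base_dom_carrier by metis
    have "face_sum R (homog (Suc n) w') ys = \<zero>\<^bsub>R\<^esub>" if dom: "set ys \<subseteq> base_dom"
    proof -
      have "face_sum R (homog (Suc n) w') ys = face_sum R (\<lambda>zs. homog (Suc n) w (map retract zs)) ys"
        using ys(2) homog_w' dom by (intro R.face_sum_cong[of base_dom]) auto
      also have "\<dots> = face_sum R (homog (Suc n) w) (map retract ys)"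
        by (rule R.face_sum_map)
      also have "\<dots> = \<zero>\<^bsub>R\<^esub>"
        using ys(2) dom retract_image by (intro face_sum_homog_w) auto
      finally show ?thesis .
    qed
    then show "coord g (coboundary G R \<beta> u (Suc n) w' xs) = coord g \<zero>\<^bsub>R\<^esub>"
      using coord_coboundary(2)[OF w'_cochain ys(1,2)] ys g base_dom_carrier by simp
  next
    obtain ys where "set ys \<subseteq> carrier G" "length ys = Suc (Suc (Suc n))" "hd ys = \<one>"
      "quotients G ys = xs"
      using G.quotients_surj[OF xs G.one_closed] by metis
    then show "coboundary G R \<beta> u (Suc n) w' xs \<in> carrier R"
      using coord_coboundary(1)[OF w'_cochain, of ys] one_in_base_dom by simp
  qed simp
  moreover have "coboundary G R \<beta> u (Suc n) w' \<in> extensional (tuples G (Suc n + 1))"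
    by (simp add: coboundary_def)
  ultimately have "coboundary G R \<beta> u (Suc n) w' = (\<lambda>xs\<in>tuples G (Suc n + 1). \<zero>\<^bsub>R\<^esub>)"
    by (intro extensionalityI[of _ "tuples G (Suc n + 1)"]) auto
  then show ?thesis using w'_cochain by (simp add: cocycles_def)
qed

end

end

section \<open>From partial actions to total maps\<close>

text \<open>The key point is \<open>\<alpha>\<^sub>g(D(g\<^sup>-\<^sup>1) \<inter> D(h)) = D(g) \<inter> D(gh)\<close>, which turns the partial composition law into
  an identity between total maps.\<close>

lemma unital_partial_rep_of_action:
  assumes P: "unital_partial_action G K A D \<alpha> u"
  shows "unital_partial_rep G A (\<lambda>g a. \<alpha> g (u (inv\<^bsub>G\<^esub> g) \<otimes>\<^bsub>A\<^esub> a)) u"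
proof -
  interpret G: group G
    using P by (simp add: unital_partial_action_def partial_action_def)
  interpret R: ring A
    using P by (simp add: unital_partial_action_def partial_action_def assoc_algebra_def)
  interpret P: unital_partial_action G K A D \<alpha> u by fact
  have u_closed [simp]: "u g \<in> carrier A"
    and u_idem: "u g \<otimes>\<^bsub>A\<^esub> u g = u g"
    and u_comm: "a \<in> carrier A \<Longrightarrow> u g \<otimes>\<^bsub>A\<^esub> a = a \<otimes>\<^bsub>A\<^esub> u g"
    if "g \<in> carrier G" for g a
    using P.unit_central_idempotent[OF that] unfolding central_idempotent_def by metis+
  have u_u: "u g \<otimes>\<^bsub>A\<^esub> (u g \<otimes>\<^bsub>A\<^esub> a) = u g \<otimes>\<^bsub>A\<^esub> a" if "g \<in> carrier G" "a \<in> carrier A" for g a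
    using that u_idem[OF that(1)] by (simp flip: R.m_assoc)
  have D_iff: "a \<in> D g \<longleftrightarrow> a \<in> carrier A \<and> u g \<otimes>\<^bsub>A\<^esub> a = a" if g: "g \<in> carrier G" for g a
  proof
    assume "a \<in> D g"
    then obtain b where "b \<in> carrier A" "a = u g \<otimes>\<^bsub>A\<^esub> b" unfolding P.dom_eq[OF g] by auto
    then show "a \<in> carrier A \<and> u g \<otimes>\<^bsub>A\<^esub> a = a" using g by (simp add: u_u)
  next
    assume "a \<in> carrier A \<and> u g \<otimes>\<^bsub>A\<^esub> a = a"
    then show "a \<in> D g" unfolding P.dom_eq[OF g] by (metis imageI)
  qed
  have \<alpha>_D: "\<alpha> g a \<in> D g" if "g \<in> carrier G" "a \<in> D (inv\<^bsub>G\<^esub> g)" for g a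
    using P.act_bij[OF that(1)] that(2) by (rule bij_betwE[rule_format])
  have D_inter: "u g \<otimes>\<^bsub>A\<^esub> (u h \<otimes>\<^bsub>A\<^esub> a) \<in> D g \<inter> D h"
    if "g \<in> carrier G" "h \<in> carrier G" "a \<in> carrier A" for g h a
  proof -
    have "u h \<otimes>\<^bsub>A\<^esub> (u g \<otimes>\<^bsub>A\<^esub> (u h \<otimes>\<^bsub>A\<^esub> a)) = u g \<otimes>\<^bsub>A\<^esub> (u h \<otimes>\<^bsub>A\<^esub> (u h \<otimes>\<^bsub>A\<^esub> a))"
      using that u_comm[of h "u g"] by (simp flip: R.m_assoc)
    then show ?thesis
      using that by (simp add: u_u D_iff)
  qed
  have \<alpha>_inv: "\<alpha> (inv\<^bsub>G\<^esub> g) a \<in> D (inv\<^bsub>G\<^esub> g)" "\<alpha> g (\<alpha> (inv\<^bsub>G\<^esub> g) a) = a"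
    if g: "g \<in> carrier G" and a: "a \<in> D g" for g a
  proof -
    show 1: "\<alpha> (inv\<^bsub>G\<^esub> g) a \<in> D (inv\<^bsub>G\<^esub> g)" using g a by (intro \<alpha>_D) simp_all
    show "\<alpha> g (\<alpha> (inv\<^bsub>G\<^esub> g) a) = a"
      using P.act_comp[of g "inv\<^bsub>G\<^esub> g" a] g a 1 P.act_one[of a] D_iff[OF g] by simp
  qed
  let ?\<beta> = "\<lambda>g a. \<alpha> g (u (inv\<^bsub>G\<^esub> g) \<otimes>\<^bsub>A\<^esub> a)"
  have u_D: "u g \<otimes>\<^bsub>A\<^esub> a \<in> D g" if "g \<in> carrier G" "a \<in> carrier A" for g a
    using that by (simp add: D_iff u_u)
  have \<beta>_D: "?\<beta> g a \<in> D g" if "g \<in> carrier G" "a \<in> carrier A" for g a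
    using that by (intro \<alpha>_D u_D) simp_all
  have \<beta>_closed: "?\<beta> g a \<in> carrier A" if "g \<in> carrier G" "a \<in> carrier A" for g a
    using \<beta>_D[OF that] D_iff[OF that(1)] by simp
  have \<alpha>_mult_\<beta>: "\<alpha> g b \<otimes>\<^bsub>A\<^esub> ?\<beta> g a = \<alpha> g (b \<otimes>\<^bsub>A\<^esub> a)"
    if g: "g \<in> carrier G" and b: "b \<in> D (inv\<^bsub>G\<^esub> g)" and a: "a \<in> carrier A" for g a b
  proof -
    have b': "b \<in> carrier A" "u (inv\<^bsub>G\<^esub> g) \<otimes>\<^bsub>A\<^esub> b = b"
      using b D_iff[of "inv\<^bsub>G\<^esub> g"] g by simp_all
    have "\<alpha> g b \<otimes>\<^bsub>A\<^esub> ?\<beta> g a = \<alpha> g (b \<otimes>\<^bsub>A\<^esub> (u (inv\<^bsub>G\<^esub> g) \<otimes>\<^bsub>A\<^esub> a))"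
      using g a b by (intro P.act_mult[symmetric] u_D) simp_all
    also have "b \<otimes>\<^bsub>A\<^esub> (u (inv\<^bsub>G\<^esub> g) \<otimes>\<^bsub>A\<^esub> a) = u (inv\<^bsub>G\<^esub> g) \<otimes>\<^bsub>A\<^esub> b \<otimes>\<^bsub>A\<^esub> a"
      using g a b'(1) by (simp add: u_comm R.m_assoc)
    finally show ?thesis by (simp only: b'(2))
  qed
  have \<beta>_one: "?\<beta> g \<one>\<^bsub>A\<^esub> = u g" if g: "g \<in> carrier G" for g
  proof -
    have u: "u g \<in> D g" using g u_D[of g "\<one>\<^bsub>A\<^esub>"] by simp
    have "u g = \<alpha> g (\<alpha> (inv\<^bsub>G\<^esub> g) (u g) \<otimes>\<^bsub>A\<^esub> \<one>\<^bsub>A\<^esub>)"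
      using \<alpha>_inv[OF g u] D_iff[of "inv\<^bsub>G\<^esub> g"] g by simp
    also have "\<dots> = u g \<otimes>\<^bsub>A\<^esub> ?\<beta> g \<one>\<^bsub>A\<^esub>"
      using g \<alpha>_inv[OF g u] by (subst \<alpha>_mult_\<beta>[symmetric]) simp_all
    also have "\<dots> = ?\<beta> g \<one>\<^bsub>A\<^esub>"
      using \<beta>_D[OF g R.one_closed] D_iff[OF g] by simp
    finally show ?thesis by simp
  qed
  have \<alpha>_inter: "\<alpha> g (u (inv\<^bsub>G\<^esub> g) \<otimes>\<^bsub>A\<^esub> u h) = u g \<otimes>\<^bsub>A\<^esub> u (g \<otimes>\<^bsub>G\<^esub> h)" (is "?v = ?p")
    if g: "g \<in> carrier G" and h: "h \<in> carrier G" for g h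
  proof -
    let ?gh = "g \<otimes>\<^bsub>G\<^esub> h"
    have gh: "?gh \<in> carrier G" using g h by simp
    have ginv: "inv\<^bsub>G\<^esub> g \<otimes>\<^bsub>G\<^esub> ?gh = h" using g h by (simp flip: G.m_assoc)
    have c: "u (inv\<^bsub>G\<^esub> g) \<otimes>\<^bsub>A\<^esub> u h \<in> D (inv\<^bsub>G\<^esub> g) \<inter> D h"
      using g h D_inter[of "inv\<^bsub>G\<^esub> g" h "\<one>\<^bsub>A\<^esub>"] by simp
    have p: "?p \<in> D g \<inter> D ?gh"
      using g gh D_inter[of g ?gh "\<one>\<^bsub>A\<^esub>"] by simp
    have v_D: "?v \<in> D g" using g c by (intro \<alpha>_D) auto
    have "?v \<in> D ?gh"
    proof -
      have "\<alpha> (inv\<^bsub>G\<^esub> g) ?v \<in> D h"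
        using g c P.act_comp[of "inv\<^bsub>G\<^esub> g" g "u (inv\<^bsub>G\<^esub> g) \<otimes>\<^bsub>A\<^esub> u h"] v_D P.act_one h by simp
      then show ?thesis
        using P.act_comp_dom[of "inv\<^bsub>G\<^esub> h" "inv\<^bsub>G\<^esub> g" ?v] g h v_D by (simp flip: G.inv_mult_group)
    qed
    then have "?p \<otimes>\<^bsub>A\<^esub> ?v = ?v"
      using v_D g gh D_iff[OF g] D_iff[OF gh] by (simp add: R.m_assoc)
    moreover have "?v \<otimes>\<^bsub>A\<^esub> ?p = ?p"
    proof -
      let ?r = "\<alpha> (inv\<^bsub>G\<^esub> g) ?p"
      have r1: "?r \<in> D (inv\<^bsub>G\<^esub> g)" "\<alpha> g ?r = ?p"
        using \<alpha>_inv[OF g, of ?p] p by auto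
      have q: "\<alpha> (inv\<^bsub>G\<^esub> ?gh) ?p \<in> D (inv\<^bsub>G\<^esub> ?gh)" "\<alpha> ?gh (\<alpha> (inv\<^bsub>G\<^esub> ?gh) ?p) = ?p"
        using \<alpha>_inv[OF gh, of ?p] p by auto
      \<comment> \<open>The composition axioms are applied to \<open>inv g\<close> after
        \<open>?gh\<close>, whose product is \<open>h\<close>.\<close>
      have "\<alpha> (inv\<^bsub>G\<^esub> ?gh) ?p \<in> D (inv\<^bsub>G\<^esub> h)"
        using P.act_comp_dom[of "inv\<^bsub>G\<^esub> g" ?gh "\<alpha> (inv\<^bsub>G\<^esub> ?gh) ?p"] g gh q p ginv by simp
      moreover have "?r = \<alpha> h (\<alpha> (inv\<^bsub>G\<^esub> ?gh) ?p)"
        using P.act_comp[of "inv\<^bsub>G\<^esub> g" ?gh "\<alpha> (inv\<^bsub>G\<^esub> ?gh) ?p"] g gh q p ginv by simp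
      ultimately have "?r \<in> D h" using \<alpha>_D[OF h] by simp
      then have "u (inv\<^bsub>G\<^esub> g) \<otimes>\<^bsub>A\<^esub> u h \<otimes>\<^bsub>A\<^esub> ?r = ?r"
        using r1(1) g h D_iff[of h] D_iff[of "inv\<^bsub>G\<^esub> g"] by (simp add: R.m_assoc)
      then show ?thesis
        using P.act_mult[of g "u (inv\<^bsub>G\<^esub> g) \<otimes>\<^bsub>A\<^esub> u h" ?r] g c r1 by simp
    qed
    moreover have "?p \<otimes>\<^bsub>A\<^esub> ?v = ?v \<otimes>\<^bsub>A\<^esub> ?p"
    proof -
      have v: "?v \<in> carrier A" using v_D D_iff[OF g] by simp
      then have "?p \<otimes>\<^bsub>A\<^esub> ?v = u g \<otimes>\<^bsub>A\<^esub> ?v \<otimes>\<^bsub>A\<^esub> u ?gh"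
        using g gh u_comm[OF gh v] by (simp add: R.m_assoc)
      then show ?thesis
        using g gh v u_comm[OF g v] by (simp add: R.m_assoc)
    qed
    ultimately show ?thesis by simp
  qed
  show ?thesis
  proof
    fix g a b assume g: "g \<in> carrier G" and a: "a \<in> carrier A" and b: "b \<in> carrier A"
    show "?\<beta> g (a \<oplus>\<^bsub>A\<^esub> b) = ?\<beta> g a \<oplus>\<^bsub>A\<^esub> ?\<beta> g b"
      using g a b u_D[of "inv\<^bsub>G\<^esub> g"] by (simp add: R.r_distr P.act_add)
    show "?\<beta> g (a \<otimes>\<^bsub>A\<^esub> b) = ?\<beta> g a \<otimes>\<^bsub>A\<^esub> ?\<beta> g b"
      using g a b u_D[of "inv\<^bsub>G\<^esub> g"] by (simp add: \<alpha>_mult_\<beta> R.m_assoc)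
  next
    fix a assume "a \<in> carrier A"
    moreover have "u \<one>\<^bsub>G\<^esub> = \<one>\<^bsub>A\<^esub>"
      using D_iff[of "\<one>\<^bsub>G\<^esub>" "\<one>\<^bsub>A\<^esub>"] by (simp add: P.dom_one)
    ultimately show "?\<beta> \<one>\<^bsub>G\<^esub> a = a" by (simp add: P.act_one)
  next
    fix g h a assume g: "g \<in> carrier G" and h: "h \<in> carrier G" and a: "a \<in> carrier A"
    let ?gh = "g \<otimes>\<^bsub>G\<^esub> h" and ?w = "u h \<otimes>\<^bsub>A\<^esub> u (inv\<^bsub>G\<^esub> g)"
    have gh: "?gh \<in> carrier G" using g h by simp
    have w: "?w \<in> D h \<inter> D (inv\<^bsub>G\<^esub> g)"
      using g h D_inter[of h "inv\<^bsub>G\<^esub> g" "\<one>\<^bsub>A\<^esub>"] by simp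
    \<comment> \<open>The idempotent \<open>?w\<close> cuts out where \<open>\<alpha> g\<close> may
      follow \<open>\<alpha> h\<close>. Multiplying \<open>a\<close> by the preimage
      \<open>c\<close> of \<open>?w\<close> brings it into the range of the partial composition
      law.\<close>
    define c where "c = \<alpha> (inv\<^bsub>G\<^esub> h) ?w"
    have c: "c \<in> D (inv\<^bsub>G\<^esub> h)" "\<alpha> h c = ?w"
      using \<alpha>_inv[OF h, of ?w] w by (auto simp: c_def)
    have c_gh: "c \<in> D (inv\<^bsub>G\<^esub> ?gh)" and c_act: "\<alpha> g ?w = \<alpha> ?gh c"
      using P.act_comp_dom[of g h c] P.act_comp[of g h c] g h c w by auto
    have ca: "c \<otimes>\<^bsub>A\<^esub> a \<in> D (inv\<^bsub>G\<^esub> h)"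
      using c(1) h a D_iff[of "inv\<^bsub>G\<^esub> h"] by (simp flip: R.m_assoc)
    have ha: "\<alpha> h (c \<otimes>\<^bsub>A\<^esub> a) = u (inv\<^bsub>G\<^esub> g) \<otimes>\<^bsub>A\<^esub> ?\<beta> h a"
    proof -
      have "\<alpha> h (c \<otimes>\<^bsub>A\<^esub> a) = ?w \<otimes>\<^bsub>A\<^esub> ?\<beta> h a"
        using \<alpha>_mult_\<beta>[OF h c(1) a] c(2) by simp
      also have "?w = u (inv\<^bsub>G\<^esub> g) \<otimes>\<^bsub>A\<^esub> u h"
        using g h by (intro u_comm) simp_all
      finally show ?thesis
        using g h \<beta>_closed[OF h a] \<beta>_D[OF h a] D_iff[OF h] by (simp add: R.m_assoc)
    qed
    have "?\<beta> g (?\<beta> h a) = \<alpha> g (\<alpha> h (c \<otimes>\<^bsub>A\<^esub> a))" by (simp only: ha)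
    also have "\<dots> = \<alpha> ?gh (c \<otimes>\<^bsub>A\<^esub> a)"
      using g h ca u_D[of "inv\<^bsub>G\<^esub> g" "?\<beta> h a"] \<beta>_closed[OF h a]
      by (intro P.act_comp) (simp_all add: ha)
    also have "\<dots> = \<alpha> g ?w \<otimes>\<^bsub>A\<^esub> ?\<beta> ?gh a"
      using \<alpha>_mult_\<beta>[OF gh c_gh a] c_act by simp
    also have "?w = u (inv\<^bsub>G\<^esub> g) \<otimes>\<^bsub>A\<^esub> u h"
      using g h by (intro u_comm) simp_all
    also have "\<alpha> g (u (inv\<^bsub>G\<^esub> g) \<otimes>\<^bsub>A\<^esub> u h) \<otimes>\<^bsub>A\<^esub> ?\<beta> ?gh a = u g \<otimes>\<^bsub>A\<^esub> ?\<beta> ?gh a"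
      using g gh \<alpha>_inter[OF g h] \<beta>_closed[OF gh a] \<beta>_D[OF gh a] D_iff[OF gh]
      by (simp add: R.m_assoc)
    finally show "?\<beta> g (?\<beta> h a) = u g \<otimes>\<^bsub>A\<^esub> ?\<beta> ?gh a" .
  qed (use \<beta>_closed \<beta>_one P.unit_central_idempotent in simp_all)
qed

section \<open>Products of indecomposable algebras\<close>

lemma prod_algebra_simps:
  "carrier (prod_algebra I A) = (\<Pi>\<^sub>E i\<in>I. carrier (A i))"
  "mult (prod_algebra I A) f h = (\<lambda>i\<in>I. f i \<otimes>\<^bsub>A i\<^esub> h i)"
  "\<zero>\<^bsub>prod_algebra I A\<^esub> = (\<lambda>i\<in>I. \<zero>\<^bsub>A i\<^esub>)"
  by (simp_all add: prod_algebra_def)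

lemma prod_algebra_eqI:
  assumes "a \<in> carrier (prod_algebra I A)" "b \<in> carrier (prod_algebra I A)"
    and "\<And>i. i \<in> I \<Longrightarrow> a i = b i"
  shows "a = b"
  using assms unfolding prod_algebra_simps by (rule PiE_ext)

lemma factor_one_mult:
  assumes "\<forall>i\<in>I. ring (A i)" "a \<in> carrier (prod_algebra I A)"
  shows "factor_one I A i \<otimes>\<^bsub>prod_algebra I A\<^esub> a = (\<lambda>j\<in>I. if j = i then a j else \<zero>\<^bsub>A j\<^esub>)"
    and "a \<otimes>\<^bsub>prod_algebra I A\<^esub> factor_one I A i = (\<lambda>j\<in>I. if j = i then a j else \<zero>\<^bsub>A j\<^esub>)"
proof -
  have "\<one>\<^bsub>A j\<^esub> \<otimes>\<^bsub>A j\<^esub> a j = a j" "\<zero>\<^bsub>A j\<^esub> \<otimes>\<^bsub>A j\<^esub> a j = \<zero>\<^bsub>A j\<^esub>"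
    "a j \<otimes>\<^bsub>A j\<^esub> \<one>\<^bsub>A j\<^esub> = a j" "a j \<otimes>\<^bsub>A j\<^esub> \<zero>\<^bsub>A j\<^esub> = \<zero>\<^bsub>A j\<^esub>" if j: "j \<in> I" for j
  proof -
    interpret ring "A j" using assms(1) j by blast
    have "a j \<in> carrier (A j)" using assms(2) j by (auto simp: prod_algebra_simps)
    then show "\<one>\<^bsub>A j\<^esub> \<otimes>\<^bsub>A j\<^esub> a j = a j" "\<zero>\<^bsub>A j\<^esub> \<otimes>\<^bsub>A j\<^esub> a j = \<zero>\<^bsub>A j\<^esub>"
      "a j \<otimes>\<^bsub>A j\<^esub> \<one>\<^bsub>A j\<^esub> = a j" "a j \<otimes>\<^bsub>A j\<^esub> \<zero>\<^bsub>A j\<^esub> = \<zero>\<^bsub>A j\<^esub>"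
      by simp_all
  qed
  then show "factor_one I A i \<otimes>\<^bsub>prod_algebra I A\<^esub> a = (\<lambda>j\<in>I. if j = i then a j else \<zero>\<^bsub>A j\<^esub>)"
    "a \<otimes>\<^bsub>prod_algebra I A\<^esub> factor_one I A i = (\<lambda>j\<in>I. if j = i then a j else \<zero>\<^bsub>A j\<^esub>)"
    by (auto simp: factor_one_def prod_algebra_simps intro!: restrict_ext)
qed

lemma factor_one_closed:
  assumes "\<forall>i\<in>I. ring (A i)"
  shows "factor_one I A i \<in> carrier (prod_algebra I A)"
proof -
  have "\<one>\<^bsub>A j\<^esub> \<in> carrier (A j)" "\<zero>\<^bsub>A j\<^esub> \<in> carrier (A j)" if j: "j \<in> I" for j
  proof -
    interpret ring "A j" using assms j by blast
    show "\<one>\<^bsub>A j\<^esub> \<in> carrier (A j)" "\<zero>\<^bsub>A j\<^esub> \<in> carrier (A j)" by simp_all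
  qed
  then show ?thesis by (auto simp: factor_one_def prod_algebra_simps)
qed

lemma factor_one_central_idempotent:
  assumes "\<forall>i\<in>I. ring (A i)"
  shows "central_idempotent (prod_algebra I A) (factor_one I A i)"
proof -
  have "factor_one I A i \<otimes>\<^bsub>prod_algebra I A\<^esub> factor_one I A i = factor_one I A i"
    using factor_one_mult(1)[OF assms factor_one_closed[OF assms], where i = i]
    by (auto simp: factor_one_def intro!: restrict_ext)
  then show ?thesis
    unfolding central_idempotent_def
    by (simp add: factor_one_mult[OF assms] factor_one_closed[OF assms])
qed

lemma central_idempotent_component:
  assumes "\<forall>i\<in>I. ring (A i)" "central_idempotent (prod_algebra I A) c" "i \<in> I"
  shows "central_idempotent (A i) (c i)"
proof -
  have c: "c \<in> carrier (prod_algebra I A)" "c \<otimes>\<^bsub>prod_algebra I A\<^esub> c = c"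
    "\<And>a. a \<in> carrier (prod_algebra I A) \<Longrightarrow>
      c \<otimes>\<^bsub>prod_algebra I A\<^esub> a = a \<otimes>\<^bsub>prod_algebra I A\<^esub> c"
    using assms(2) unfolding central_idempotent_def by blast+
  have "c i \<otimes>\<^bsub>A i\<^esub> x = x \<otimes>\<^bsub>A i\<^esub> c i" if x: "x \<in> carrier (A i)" for x
  proof -
    \<comment> \<open>Centrality in the product is tested on the element with \<open>x\<close> in
      place \<open>i\<close> and zero elsewhere.\<close>
    let ?a = "\<lambda>j\<in>I. if j = i then x else \<zero>\<^bsub>A j\<^esub>"
    have "\<zero>\<^bsub>A j\<^esub> \<in> carrier (A j)" if "j \<in> I" for j
      using bspec[OF assms(1) that] by (simp add: ring_def abelian_group_def abelian_monoid.zero_closed)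
    then have "?a \<in> carrier (prod_algebra I A)" using x by (auto simp: prod_algebra_simps)
    from fun_cong[OF c(3)[OF this], of i] show ?thesis
      using assms(3) by (simp add: prod_algebra_simps)
  qed
  moreover have "c i \<otimes>\<^bsub>A i\<^esub> c i = c i"
    using fun_cong[OF c(2), of i] assms(3) by (simp add: prod_algebra_simps)
  ultimately show ?thesis
    using c(1) assms(3) by (auto simp: central_idempotent_def prod_algebra_simps)
qed

section \<open>The partial action on a product of indecomposable algebras\<close>

locale product_partial_action =
  fixes G :: "('g, 'm) monoid_scheme" (structure) and K :: "('k, 'c) ring_scheme"
    and I :: "'i set" and A :: "'i \<Rightarrow> ('k, 'a) module"
    and D :: "'g \<Rightarrow> ('i \<Rightarrow> 'a) set" and \<alpha> :: "'g \<Rightarrow> ('i \<Rightarrow> 'a) \<Rightarrow> ('i \<Rightarrow> 'a)"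
    and u :: "'g \<Rightarrow> 'i \<Rightarrow> 'a" and l0 :: 'i and T :: "'g set"
  assumes indecomposable: "i \<in> I \<Longrightarrow> indecomposable_ring (A i)"
    and action: "unital_partial_action G K (prod_algebra I A) D \<alpha> u"
    and transitive: "transitive_action G I A D \<alpha>"
    and base: "l0 \<in> I"
    and transversal_T: "left_transversal G (factor_stabilizer G I A D \<alpha> l0) T"
begin

definition ext_act :: "'g \<Rightarrow> ('i \<Rightarrow> 'a) \<Rightarrow> 'i \<Rightarrow> 'a" where
  "ext_act g a = \<alpha> g (u (inv g) \<otimes>\<^bsub>prod_algebra I A\<^esub> a)"

lemma factor_ring: "\<forall>i\<in>I. ring (A i)"
  using indecomposable by (simp add: indecomposable_ring_def)

lemma factor_one_neq_zero:
  assumes "i \<in> I"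
  shows "factor_one I A i \<noteq> \<zero>\<^bsub>prod_algebra I A\<^esub>"
proof
  assume "factor_one I A i = \<zero>\<^bsub>prod_algebra I A\<^esub>"
  from fun_cong[OF this, of i] show False
    using indecomposable[OF assms] assms by (simp add: factor_one_def indecomposable_ring_def prod_algebra_simps)
qed

text \<open>The component of \<open>c\<close> at \<open>i\<close> is a central idempotent of an
  indecomposable ring, hence zero or one.\<close>

lemma factor_one_cases:
  assumes "central_idempotent (prod_algebra I A) c" "i \<in> I"
  shows "factor_one I A i \<otimes>\<^bsub>prod_algebra I A\<^esub> c = \<zero>\<^bsub>prod_algebra I A\<^esub> \<or>
    factor_one I A i \<otimes>\<^bsub>prod_algebra I A\<^esub> c = factor_one I A i"
proof -
  have c: "c \<in> carrier (prod_algebra I A)" using assms by (simp add: central_idempotent_def)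
  have "c i = \<zero>\<^bsub>A i\<^esub> \<or> c i = \<one>\<^bsub>A i\<^esub>"
    using indecomposable[OF assms(2)] central_idempotent_component[OF factor_ring assms]
    by (simp add: indecomposable_ring_def)
  then show ?thesis
    unfolding factor_one_mult(1)[OF factor_ring c] unfolding factor_one_def prod_algebra_simps
    by (elim disj_forward) (auto intro!: restrict_ext)
qed

sublocale based_partial_rep G "prod_algebra I A" ext_act u "factor_one I A l0"
proof -
  interpret unital_partial_rep G "prod_algebra I A" ext_act u
    using unital_partial_rep_of_action[OF action] unfolding ext_act_def .
  show "based_partial_rep G (prod_algebra I A) ext_act u (factor_one I A l0)"
  proof
    show "central_idempotent (prod_algebra I A) (factor_one I A l0)"
      using factor_ring by (rule factor_one_central_idempotent)
    show "factor_one I A l0 \<noteq> \<zero>\<^bsub>prod_algebra I A\<^esub>"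
      using base by (rule factor_one_neq_zero)
    show "c = \<zero>\<^bsub>prod_algebra I A\<^esub> \<or> c = factor_one I A l0"
      if "central_idempotent (prod_algebra I A) c"
        "factor_one I A l0 \<otimes>\<^bsub>prod_algebra I A\<^esub> c = c" for c
      using factor_one_cases[OF that(1) base] that(2) by simp
  qed
qed

abbreviation R where "R \<equiv> prod_algebra I A"

lemma D_iff:
  assumes "g \<in> carrier G"
  shows "a \<in> D g \<longleftrightarrow> a \<in> carrier R \<and> u g \<otimes>\<^bsub>R\<^esub> a = a"
proof -
  have D: "D g = (\<lambda>a. u g \<otimes>\<^bsub>R\<^esub> a) ` carrier R"
    by (rule unital_partial_action.dom_eq[OF action]) fact
  have idem: "u g \<otimes>\<^bsub>R\<^esub> u g = u g"
    using u_central_idempotent[OF assms] unfolding central_idempotent_def by blast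
  have "u g \<otimes>\<^bsub>R\<^esub> (u g \<otimes>\<^bsub>R\<^esub> b) = u g \<otimes>\<^bsub>R\<^esub> b" if "b \<in> carrier R" for b
    using R.m_assoc[OF u_closed[OF assms] u_closed[OF assms] that] by (simp only: idem)
  then show ?thesis
    unfolding D using R.m_closed[OF u_closed[OF assms]] by (auto simp: image_iff) metis
qed

lemma \<alpha>_eq: "\<lbrakk>g \<in> carrier G; a \<in> D (inv g)\<rbrakk> \<Longrightarrow> \<alpha> g a = ext_act g a"
  using D_iff[of "inv g" a] by (simp add: ext_act_def)

lemma factor_eq: "factor I A i = {a \<in> carrier R. factor_one I A i \<otimes>\<^bsub>R\<^esub> a = a}"
proof -
  have e: "factor_one I A i \<in> carrier R"
    using factor_ring by (rule factor_one_closed)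
  have idem: "factor_one I A i \<otimes>\<^bsub>R\<^esub> factor_one I A i = factor_one I A i"
    using factor_one_central_idempotent[OF factor_ring] unfolding central_idempotent_def by blast
  have "factor_one I A i \<otimes>\<^bsub>R\<^esub> (factor_one I A i \<otimes>\<^bsub>R\<^esub> a) = factor_one I A i \<otimes>\<^bsub>R\<^esub> a"
    if "a \<in> carrier R" for a
    using R.m_assoc[OF e e that] by (simp only: idem)
  then show ?thesis
    unfolding factor_def using R.m_closed[OF e]
    by (auto simp: image_iff) metis
qed

lemma factor_subset_D_iff:
  assumes "g \<in> carrier G"
  shows "factor I A l0 \<subseteq> D (inv g) \<longleftrightarrow> g \<in> base_dom"
proof
  assume "factor I A l0 \<subseteq> D (inv g)"
  then have "factor_one I A l0 \<in> D (inv g)"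
    using e_closed e_idem by (auto simp: factor_eq)
  then show "g \<in> base_dom"
    using assms D_iff[of "inv g"] u_comm[of "inv g" "factor_one I A l0"]
    by (simp add: base_dom_def)
next
  assume g: "g \<in> base_dom"
  then have e: "u (inv g) \<otimes>\<^bsub>R\<^esub> factor_one I A l0 = factor_one I A l0"
    using assms u_comm[of "inv g" "factor_one I A l0"] e_closed
    by (simp add: base_dom_def)
  show "factor I A l0 \<subseteq> D (inv g)"
  proof
    fix a assume "a \<in> factor I A l0"
    then have a: "a \<in> carrier R" "factor_one I A l0 \<otimes>\<^bsub>R\<^esub> a = a"
      by (auto simp: factor_eq)
    have "u (inv g) \<otimes>\<^bsub>R\<^esub> (factor_one I A l0 \<otimes>\<^bsub>R\<^esub> a) = factor_one I A l0 \<otimes>\<^bsub>R\<^esub> a"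
      using R.m_assoc[OF u_closed[OF G.inv_closed[OF assms]] e_closed a(1)] by (simp only: e)
    then show "a \<in> D (inv g)"
      using assms a D_iff[of "inv g" a] by (simp)
  qed
qed

text \<open>The image is the ideal generated by the central idempotent \<open>?f\<close>, and two
  central idempotents generating the same ideal absorb each other, hence agree.\<close>

lemma \<alpha>_image_factor_iff:
  assumes g: "g \<in> base_dom" and i: "i \<in> I"
  shows "\<alpha> g ` factor I A l0 = factor I A i \<longleftrightarrow> ext_act g (factor_one I A l0) = factor_one I A i"
proof -
  let ?e = "factor_one I A l0"
  let ?f = "ext_act g ?e"
  have gc: "g \<in> carrier G" by (rule base_dom_carrier) fact
  have e_f: "?f \<in> carrier R" using gc by (rule \<beta>_closed) (rule e_closed)
  have f: "central_idempotent R ?f"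
    using gc e_central_idempotent by (rule \<beta>_central_idempotent)
  have "\<alpha> g ` factor I A l0 = ext_act g ` factor I A l0"
    using \<alpha>_eq[OF gc] factor_subset_D_iff[OF gc] g by (intro image_cong) auto
  also have "\<dots> = {a \<in> carrier R. ?f \<otimes>\<^bsub>R\<^esub> a = a}"
  proof (intro equalityI subsetI)
    fix a assume "a \<in> ext_act g ` factor I A l0"
    then obtain b where b: "b \<in> carrier R" "?e \<otimes>\<^bsub>R\<^esub> b = b" "a = ext_act g b"
      by (auto simp: factor_eq)
    then show "a \<in> {a \<in> carrier R. ?f \<otimes>\<^bsub>R\<^esub> a = a}"
      using \<beta>_mult[OF gc e_closed b(1)] \<beta>_closed[OF gc b(1)] by (simp)
  next
    fix a assume "a \<in> {a \<in> carrier R. ?f \<otimes>\<^bsub>R\<^esub> a = a}"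
    then have a: "a \<in> carrier R" "?f \<otimes>\<^bsub>R\<^esub> a = a" by auto
    \<comment> \<open>The coordinate of \<open>a\<close> is the preimage in the base factor.\<close>
    then have "a = ext_act g (coord g a)"
      using \<beta>_coord[OF g a(1)] by simp
    moreover have "coord g a \<in> factor I A l0"
      using e_coord[OF gc a(1)] coord_closed[OF gc a(1)]
      by (simp add: factor_eq)
    ultimately show "a \<in> ext_act g ` factor I A l0" by blast
  qed
  finally have image: "\<alpha> g ` factor I A l0 = {a \<in> carrier R. ?f \<otimes>\<^bsub>R\<^esub> a = a}" .
  have ei: "central_idempotent R (factor_one I A i)"
    using factor_ring by (rule factor_one_central_idempotent)
  show ?thesis
  proof
    assume "\<alpha> g ` factor I A l0 = factor I A i"
    then have "{a \<in> carrier R. ?f \<otimes>\<^bsub>R\<^esub> a = a} = {a \<in> carrier R. factor_one I A i \<otimes>\<^bsub>R\<^esub> a = a}"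
      by (simp only: image factor_eq[of i])
    then have "?f \<otimes>\<^bsub>R\<^esub> factor_one I A i = factor_one I A i" "factor_one I A i \<otimes>\<^bsub>R\<^esub> ?f = ?f"
      using ei f unfolding central_idempotent_def by blast+
    then show "?f = factor_one I A i"
      using ei e_f unfolding central_idempotent_def by metis
  qed (simp only: image factor_eq[of i])
qed

lemma stabilizer_eq: "factor_stabilizer G I A D \<alpha> l0 = base_stab"
proof (rule Set.set_eqI)
  fix x
  show "x \<in> factor_stabilizer G I A D \<alpha> l0 \<longleftrightarrow> x \<in> base_stab"
    using factor_subset_D_iff[of x] \<alpha>_image_factor_iff[of x, OF _ base] base_dom_carrier[of x]
    by (auto simp: factor_stabilizer_def base_stab_iff)
qed

sublocale transversal_partial_rep G "prod_algebra I A" ext_act u "factor_one I A l0" T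
  by standard (use transversal_T in \<open>simp add: stabilizer_eq\<close>)

lemma index_reps_eq: "index_reps G I A D l0 T = T \<inter> base_dom"
proof -
  have "T \<subseteq> carrier G" using transversal by (simp add: left_transversal_def)
  then show ?thesis
    using factor_subset_D_iff by (auto simp: index_reps_def)
qed

text \<open>The image of the base unit is nonzero, so it has a nonzero component. The unit of the
  corresponding factor then lies below it, and \<open>\<beta>_e_primitive\<close> forces
  equality.\<close>

lemma ext_act_factor_one:
  assumes g: "g \<in> base_dom"
  obtains i where "i \<in> I" "ext_act g (factor_one I A l0) = factor_one I A i"
proof -
  let ?f = "ext_act g (factor_one I A l0)"
  have gc: "g \<in> carrier G" by (rule base_dom_carrier) fact
  have f: "central_idempotent R ?f"
    using gc e_central_idempotent by (rule \<beta>_central_idempotent)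
  then have fc: "?f \<in> carrier R" by (simp add: central_idempotent_def)
  have "?f \<noteq> \<zero>\<^bsub>R\<^esub>"
    using \<beta>_inv_\<beta>_e[OF g] \<beta>_zero[OF G.inv_closed[OF gc]] e_nonzero by auto
  then obtain i where i: "i \<in> I" "?f i \<noteq> \<zero>\<^bsub>R\<^esub> i"
    using prod_algebra_eqI[OF fc R.zero_closed] by blast
  then have "factor_one I A i \<otimes>\<^bsub>R\<^esub> ?f \<noteq> \<zero>\<^bsub>R\<^esub>"
    unfolding factor_one_mult(1)[OF factor_ring fc]
    by (auto dest: fun_cong[where x = i])
  then have "factor_one I A i \<otimes>\<^bsub>R\<^esub> ?f = factor_one I A i"
    using factor_one_cases[OF f i(1)] by blast
  then have "?f \<otimes>\<^bsub>R\<^esub> factor_one I A i = factor_one I A i"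
    using f factor_one_closed[OF factor_ring, of i] unfolding central_idempotent_def by simp
  with g have "?f = factor_one I A i"
    by (intro \<beta>_e_primitive factor_one_central_idempotent factor_ring factor_one_neq_zero i(1))
  with i(1) show thesis by (rule that)
qed

lemma rep_of_index_eqI:
  assumes "g \<in> T \<inter> base_dom" "ext_act g (factor_one I A l0) = factor_one I A i" "i \<in> I"
  shows "rep_of_index G I A D \<alpha> l0 T i = g"
  unfolding rep_of_index_def index_reps_eq
proof (rule the_equality)
  show "g \<in> T \<inter> base_dom \<and> \<alpha> g ` factor I A l0 = factor I A i"
    using assms \<alpha>_image_factor_iff by blast
  fix h assume h: "h \<in> T \<inter> base_dom \<and> \<alpha> h ` factor I A l0 = factor I A i"
  then have "ext_act h (factor_one I A l0) = factor_one I A i"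
    using assms(3) \<alpha>_image_factor_iff by blast
  with h assms show "h = g" by (intro \<beta>_e_inj) auto
qed

text \<open>Transitivity supplies some \<open>x\<close> carrying the base factor to the factor at
  \<open>i\<close>; \<open>rep x\<close> does the same, as the target depends only on the left
  coset.\<close>

lemma rep_of_index:
  assumes "i \<in> I"
  shows "rep_of_index G I A D \<alpha> l0 T i \<in> T \<inter> base_dom"
    and "ext_act (rep_of_index G I A D \<alpha> l0 T i) (factor_one I A l0) = factor_one I A i"
proof -
  obtain x where "x \<in> carrier G" "factor I A l0 \<subseteq> D (inv x)" "\<alpha> x ` factor I A l0 = factor I A i"
    using transitive base assms unfolding transitive_action_def by blast
  then have x: "x \<in> carrier G" "x \<in> base_dom" "ext_act x (factor_one I A l0) = factor_one I A i"
    using factor_subset_D_iff \<alpha>_image_factor_iff assms by blast+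
  have r: "rep x \<in> T \<inter> base_dom"
    using x rep(1) rep_base_dom by blast
  moreover have e: "ext_act (rep x) (factor_one I A l0) = factor_one I A i"
    using \<beta>_mult_stab[of "rep x" "retract x"] r x retract_base_stab rep_retract by simp
  ultimately have "rep_of_index G I A D \<alpha> l0 T i = rep x"
    using assms by (rule rep_of_index_eqI)
  with r e show "rep_of_index G I A D \<alpha> l0 T i \<in> T \<inter> base_dom"
    "ext_act (rep_of_index G I A D \<alpha> l0 T i) (factor_one I A l0) = factor_one I A i"
    by simp_all
qed

lemma theta_eq:
  assumes "g \<in> base_dom" "a \<in> carrier R"
  shows "theta I A \<alpha> l0 g a = ext_act g (factor_one I A l0 \<otimes>\<^bsub>R\<^esub> a)"
proof -
  have "factor_one I A l0 \<otimes>\<^bsub>R\<^esub> a \<in> factor I A l0"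
    using assms(2) unfolding factor_def by blast
  then show ?thesis
    using factor_subset_D_iff \<alpha>_eq assms(1) base_dom_carrier unfolding theta_def by blast
qed

sublocale glued_partial_rep G "prod_algebra I A" ext_act u "factor_one I A l0" T
  "\<lambda>b. family_prod G I A D \<alpha> l0 T (\<lambda>g. theta I A \<alpha> l0 g (b g))"
proof
  fix a b assume a: "a \<in> carrier R" and b: "b \<in> carrier R"
    and eq: "\<And>g. g \<in> base_dom \<Longrightarrow> coord g a = coord g b"
  show "a = b"
  proof (rule prod_algebra_eqI[OF a b])
    fix i assume i: "i \<in> I"
    let ?g = "rep_of_index G I A D \<alpha> l0 T i"
    have g: "?g \<in> base_dom" using rep_of_index(1)[OF i] by blast
    \<comment> \<open>The coordinate at the representative of \<open>i\<close> determines the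
      component at \<open>i\<close>, by \<open>\<beta>_coord\<close>.\<close>
    have "factor_one I A i \<otimes>\<^bsub>R\<^esub> a = factor_one I A i \<otimes>\<^bsub>R\<^esub> b"
      using \<beta>_coord[OF g a] \<beta>_coord[OF g b] eq[OF g] by (simp only: rep_of_index(2)[OF i])
    then show "a i = b i"
      unfolding factor_one_mult(1)[OF factor_ring a] factor_one_mult(1)[OF factor_ring b]
      using i by (auto dest: fun_cong[where x = i])
  qed
next
  fix f :: "'g \<Rightarrow> 'i \<Rightarrow> 'a" assume f: "\<And>g. g \<in> T \<inter> base_dom \<Longrightarrow> f g \<in> carrier R"
  have theta_closed: "theta I A \<alpha> l0 g (f g) \<in> carrier R" if "g \<in> T \<inter> base_dom" for g
  proof -
    have g: "g \<in> base_dom" using that by blast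
    show ?thesis
      unfolding theta_eq[OF g f[OF that]]
      by (intro \<beta>_closed R.m_closed e_closed f[OF that] base_dom_carrier[OF g])
  qed
  let ?p = "family_prod G I A D \<alpha> l0 T (\<lambda>g. theta I A \<alpha> l0 g (f g))"
  show p: "?p \<in> carrier R"
    using theta_closed rep_of_index(1) by (fastforce simp: family_prod_def prod_algebra_simps)
  fix g assume g: "g \<in> T \<inter> base_dom"
  then have gd: "g \<in> base_dom" and gc: "g \<in> carrier G" using base_dom_carrier by auto
  obtain i where i: "i \<in> I" "ext_act g (factor_one I A l0) = factor_one I A i"
    using gd by (rule ext_act_factor_one)
  have r: "rep_of_index G I A D \<alpha> l0 T i = g"
    using g i by (intro rep_of_index_eqI)
  have ef: "factor_one I A l0 \<otimes>\<^bsub>R\<^esub> f g \<in> carrier R"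
    using R.m_closed[OF e_closed f[OF g]] .
  \<comment> \<open>The coordinate at \<open>g\<close> sees only the component at \<open>i\<close>,
    which the product takes from the member of the family at \<open>g\<close>.\<close>
  have "factor_one I A i \<otimes>\<^bsub>R\<^esub> ?p = factor_one I A i \<otimes>\<^bsub>R\<^esub> theta I A \<alpha> l0 g (f g)"
    unfolding factor_one_mult(1)[OF factor_ring p] factor_one_mult(1)[OF factor_ring theta_closed[OF g]]
    using i(1) r by (auto simp: family_prod_def intro!: restrict_ext)
  also have "\<dots> = ext_act g (factor_one I A l0 \<otimes>\<^bsub>R\<^esub> f g)"
    unfolding theta_eq[OF gd f[OF g]] i(2)[symmetric] \<beta>_mult[OF gc e_closed ef, symmetric]
    by (simp only: e_e_mult[OF f[OF g]])
  finally have "coord g ?p = ext_act (inv g) (ext_act g (factor_one I A l0 \<otimes>\<^bsub>R\<^esub> f g))"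
    using coord_eq[OF gd p] i(2) by simp
  also have "\<dots> = ext_act (inv g) (ext_act g (factor_one I A l0)) \<otimes>\<^bsub>R\<^esub>
      ext_act (inv g) (ext_act g (f g))"
    unfolding \<beta>_mult[OF gc e_closed f[OF g]]
    using gc \<beta>_closed[OF gc e_closed] \<beta>_closed[OF gc f[OF g]] by (intro \<beta>_mult) simp_all
  also have "\<dots> = factor_one I A l0 \<otimes>\<^bsub>R\<^esub> (u (inv g) \<otimes>\<^bsub>R\<^esub> f g)"
    unfolding \<beta>_inv_\<beta>_e[OF gd] \<beta>_inv_\<beta>[OF gc f[OF g]] ..
  also have "\<dots> = factor_one I A l0 \<otimes>\<^bsub>R\<^esub> f g"
    using gd R.m_assoc[OF e_closed u_closed f[OF g], of "inv g"] gc
    unfolding base_dom_def by (simp)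
  finally show "coord g ?p = coord \<one> (f g)"
    unfolding coord_unit[OF f[OF g]] .
qed

text \<open>The coboundary applies \<alpha> only inside its domain, where it agrees with
  \<open>ext_act\<close>; the values of the cochain \<open>f\<close> lie in the carrier.\<close>

lemma coboundary_eq:
  assumes "f \<in> cochains G R u n"
  shows "coboundary G R \<alpha> u n f = coboundary G R ext_act u n f"
proof -
  have "\<alpha> (hd xs) (u (inv hd xs) \<otimes>\<^bsub>R\<^esub> f (tl xs)) =
      ext_act (hd xs) (u (inv hd xs) \<otimes>\<^bsub>R\<^esub> f (tl xs))" if xs: "xs \<in> tuples G (n + 1)" for xs
  proof (rule \<alpha>_eq)
    obtain x zs where "xs = x # zs" using xs by (cases xs) (auto simp: tuples_def)
    with xs have "hd xs \<in> carrier G" "tl xs \<in> tuples G n" by (auto simp: tuples_def)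
    then show "hd xs \<in> carrier G" "u (inv hd xs) \<otimes>\<^bsub>R\<^esub> f (tl xs) \<in> D (inv hd xs)"
      using unital_partial_action.dom_eq[OF action, of "inv hd xs"] cochain_closed[OF assms]
      by blast+
  qed
  then show ?thesis unfolding coboundary_def by (simp cong: restrict_cong)
qed

lemma cocycles_eq: "cocycles G R \<alpha> u n = cocycles G R ext_act u n"
  unfolding cocycles_def using coboundary_eq by auto

end

theorem theorem3p17:
  fixes G :: "('g, 'm) monoid_scheme" and K :: "('k, 'c) ring_scheme"
    and I :: "'i set" and A :: "'i \<Rightarrow> ('k, 'a) module"
    and D :: "'g \<Rightarrow> ('i \<Rightarrow> 'a) set" and \<alpha> :: "'g \<Rightarrow> ('i \<Rightarrow> 'a) \<Rightarrow> ('i \<Rightarrow> 'a)"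
    and u :: "'g \<Rightarrow> 'i \<Rightarrow> 'a" and l0 :: 'i and T :: "'g set"
    and n :: nat and w :: "'g list \<Rightarrow> 'i \<Rightarrow> 'a"
  assumes "\<And>i. i \<in> I \<Longrightarrow> assoc_algebra K (A i)"
    and "\<And>i. i \<in> I \<Longrightarrow> indecomposable_ring (A i)"
    and "unital_partial_action G K (prod_algebra I A) D \<alpha> u"
    and "transitive_action G I A D \<alpha>"
    and "l0 \<in> I"
    and "left_transversal G (factor_stabilizer G I A D \<alpha> l0) T"
    and "\<one>\<^bsub>G\<^esub> \<in> T"
    and "n > 0"
    and "w \<in> cocycles G (prod_algebra I A) \<alpha> u n"
  shows "w_prime G I A D \<alpha> u l0 T n w \<in> cochains G (prod_algebra I A) u n \<and>
    epsilon G I A D \<alpha> u l0 T n w \<in> cochains G (prod_algebra I A) u (n - 1) \<and>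
    w = (\<lambda>xs\<in>tuples G n.
           coboundary G (prod_algebra I A) \<alpha> u (n - 1) (epsilon G I A D \<alpha> u l0 T n w) xs
           \<oplus>\<^bsub>prod_algebra I A\<^esub> w_prime G I A D \<alpha> u l0 T n w xs) \<and>
    w_prime G I A D \<alpha> u l0 T n w \<in> cocycles G (prod_algebra I A) \<alpha> u n"
proof -
  interpret product_partial_action G K I A D \<alpha> u l0 T
    by (rule product_partial_action.intro) (fact assms)+
  \<comment> \<open>The homotopy results are stated for degree \<open>Suc m\<close>, with
    \<open>\<epsilon>\<close> in degree \<open>m\<close>.\<close>
  obtain m where n: "n = Suc m" using \<open>n > 0\<close> by (cases n) auto
  have w: "w \<in> cocycles G R ext_act u (Suc m)"
    using assms(9) by (simp only: cocycles_eq n)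
  have e: "epsilon G I A D \<alpha> u l0 T n w \<in> cochains G R u m"
    using \<epsilon>_cochain[OF w] unfolding epsilon_def n stabilizer_eq by simp
  have w': "w_prime G I A D \<alpha> u l0 T n w \<in> cochains G R u n"
    using w'_cochain[OF w] unfolding w_prime_def n stabilizer_eq .
  have "w = (\<lambda>xs\<in>tuples G n. coboundary G R ext_act u m (epsilon G I A D \<alpha> u l0 T n w) xs
      \<oplus>\<^bsub>R\<^esub> w_prime G I A D \<alpha> u l0 T n w xs)"
    using w_eq[OF w] unfolding w_prime_def epsilon_def n stabilizer_eq diff_Suc_1 .
  moreover have "w_prime G I A D \<alpha> u l0 T n w \<in> cocycles G R ext_act u n"
    using w'_cocycle[OF w] unfolding w_prime_def n stabilizer_eq .
  \<comment> \<open>The total maps are turned back into \<alpha>; for the coboundary this uses that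
    \<open>epsilon\<close> is a cochain.\<close>
  ultimately show ?thesis
    using e w' unfolding cocycles_eq coboundary_eq[OF e[unfolded n]] n diff_Suc_1 by blast
qed

end
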